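(* Let $M$ be a complete subset of an $\mathbb R$-tree (with a distinguished point $0\in M$). If there is a point $b\in Br(M)\setminus M$, then: (a) there exist $\mu\neq\nu$ in $\mathrm{ext}(B_{\mathcal F(M)})$ such that $\|\mu-\nu\|<2$; (b) there exist $f\neq g$ in $\mathrm{ext}(B_{\mathrm{Lip}_0(M)})$ such that $\|f-g\|_L<2$.
   Context: All Banach spaces are real; $B_X$ denotes the closed unit ball of a Banach space $X$ and $\mathrm{ext}(C)$ the set of extreme points of a convex set $C$. For a metric space $(M,d)$ with a distinguished point $0\in M$, $\mathrm{Lip}_0(M)$ is the Banach space of Lipschitz functions $f:M\to\mathbb R$ with $f(0)=0$, with norm $\|f\|_L=\sup\{\frac{f(x)-f(y)}{d(x,y)}:x\neq y\}$. The Lipschitz-free space $\mathcal F(M)$ is the norm-closed linear span of $\{\delta_x:x\in M\}$ in $\mathrm{Lip}_0(M)^*$, where $\delta_x(f)=f(x)$. An $\mathbb R$-tree is a geodesic metric space $(T,d)$ satisfying the 4-point condition: $d(a,b)+d(c,e)\le\max\{d(a,c)+d(b,e),\,d(b,c)+d(a,e)\}$ for all $a,b,c,e\in T$. For $x,y\in T$, the segment $[x,y]$ is the range of the unique isometric embedding $\phi_{x,y}:[0,d(x,y)]\to T$ with $\phi_{x,y}(0)=x$, $\phi_{x,y}(d(x,y))=y$. A point $b$ of an $\mathbb R$-tree $T$ is a branching point of $T$ if there are three distinct points $x,y,z\in T\setminus\{b\}$ with $[x,b]\cap[y,b]=[x,b]\cap[z,b]=[y,b]\cap[z,b]=\{b\}$.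 For a subset $M$ of an $\mathbb R$-tree, $\mathrm{conv}(M)=\bigcup\{[x,y]:x,y\in M\}$ (the minimal $\mathbb R$-tree containing $M$, unique up to isometry), and $Br(M)$ denotes the set of all branching points of the $\mathbb R$-tree $\mathrm{conv}(M)$. *)

theory Defs
  imports "HOL-Analysis.Analysis" "HOL-Library.Function_Algebras"
begin

text \<open>Functions into a real vector space form a real vector space under the pointwise operations.
  Lipschitz functions and functionals on them are vectors of such function types, so that the
  library notions of linear span and extreme point apply to them.\<close>

instantiation "fun" :: (type, scaleR) scaleR
begin

definition "c *\<^sub>R f = (\<lambda>x. c *\<^sub>R f x)"

instance ..

end

lemma scaleR_fun_apply [simp]: "(c *\<^sub>R f) x = c *\<^sub>R f x"
  by (simp add: scaleR_fun_def)

instance "fun" :: (type, real_vector) real_vector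
  by standard (simp_all add: fun_eq_iff scaleR_add_right scaleR_add_left)


section \<open>R-trees\<close>

definition isometric_path :: "'a::metric_space set \<Rightarrow> (real \<Rightarrow> 'a) \<Rightarrow> 'a \<Rightarrow> 'a \<Rightarrow> bool" where
  "isometric_path T \<phi> x y \<longleftrightarrow>
     \<phi> ` {0..dist x y} \<subseteq> T \<and>
     (\<forall>s\<in>{0..dist x y}. \<forall>t\<in>{0..dist x y}. dist (\<phi> s) (\<phi> t) = \<bar>s - t\<bar>) \<and>
     \<phi> 0 = x \<and> \<phi> (dist x y) = y"

definition geodesic_set :: "'a::metric_space set \<Rightarrow> bool" where
  "geodesic_set T \<longleftrightarrow> (\<forall>x\<in>T. \<forall>y\<in>T. \<exists>\<phi>. isometric_path T \<phi> x y)"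

definition four_point_condition :: "'a::metric_space set \<Rightarrow> bool" where
  "four_point_condition T \<longleftrightarrow>
     (\<forall>a\<in>T. \<forall>b\<in>T. \<forall>c\<in>T. \<forall>e\<in>T.
        dist a b + dist c e \<le> max (dist a c + dist b e) (dist b c + dist a e))"

definition R_tree :: "'a::metric_space set \<Rightarrow> bool" where
  "R_tree T \<longleftrightarrow> geodesic_set T \<and> four_point_condition T"

definition segment :: "'a::metric_space set \<Rightarrow> 'a \<Rightarrow> 'a \<Rightarrow> 'a set" where
  "segment T x y = (THE S. \<exists>\<phi>. isometric_path T \<phi> x y \<and> S = \<phi> ` {0..dist x y})"

definition branching_point :: "'a::metric_space set \<Rightarrow> 'a \<Rightarrow> bool" where
  "branching_point T b \<longleftrightarrow> b \<in> T \<and>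
     (\<exists>x\<in>T - {b}. \<exists>y\<in>T - {b}. \<exists>z\<in>T - {b}. x \<noteq> y \<and> x \<noteq> z \<and> y \<noteq> z \<and>
        segment T x b \<inter> segment T y b = {b} \<and>
        segment T x b \<inter> segment T z b = {b} \<and>
        segment T y b \<inter> segment T z b = {b})"

definition tree_conv :: "'a::metric_space set \<Rightarrow> 'a set \<Rightarrow> 'a set" where
  "tree_conv T M = (\<Union>x\<in>M. \<Union>y\<in>M. segment T x y)"

definition Br :: "'a::metric_space set \<Rightarrow> 'a set \<Rightarrow> 'a set" where
  "Br T M = {b. branching_point (tree_conv T M) b}"

text \<open>The range of an isometric path is unique, so the description in \<^const>\<open>segment\<close> is proper,
  and \<^const>\<open>tree_conv\<close> is again an R-tree.\<close>

lemma isometric_path_image: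
  assumes T: "four_point_condition T" and "x \<in> T" "y \<in> T" and \<phi>: "isometric_path T \<phi> x y"
  shows "\<phi> ` {0..dist x y} = {w\<in>T. dist x w + dist w y = dist x y}"
proof (intro equalityI subsetI)
  fix w assume "w \<in> \<phi> ` {0..dist x y}"
  then obtain s where s: "s \<in> {0..dist x y}" "w = \<phi> s" by blast
  have ends: "\<phi> 0 = x" "\<phi> (dist x y) = y"
    and iso: "\<forall>s\<in>{0..dist x y}. \<forall>t\<in>{0..dist x y}. dist (\<phi> s) (\<phi> t) = \<bar>s - t\<bar>" and "w \<in> T"
    using \<phi> s unfolding isometric_path_def by blast+
  have "dist x w = s" "dist w y = dist x y - s"
    using iso[rule_format, of 0 s] iso[rule_format, of s "dist x y"] s(1)
    unfolding ends s(2) by simp_all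
  then show "w \<in> {w\<in>T. dist x w + dist w y = dist x y}"
    using \<open>w \<in> T\<close> by simp
next
  fix w assume w: "w \<in> {w\<in>T. dist x w + dist w y = dist x y}"
  define s where "s = dist x w"
  have s: "s \<in> {0..dist x y}" using w zero_le_dist[of w y] zero_le_dist[of x w] unfolding s_def
    by (simp del: zero_le_dist)
  have ends: "\<phi> 0 = x" "\<phi> (dist x y) = y"
    and iso: "\<forall>s\<in>{0..dist x y}. \<forall>t\<in>{0..dist x y}. dist (\<phi> s) (\<phi> t) = \<bar>s - t\<bar>"
    and sT: "\<phi> s \<in> T"
    using \<phi> s unfolding isometric_path_def by blast+
  have d: "dist x (\<phi> s) = s" "dist (\<phi> s) y = dist x y - s"
    using iso[rule_format, of 0 s] iso[rule_format, of s "dist x y"] s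
    unfolding ends by simp_all
  have "dist w (\<phi> s) + dist x y \<le> max (dist w x + dist (\<phi> s) y) (dist (\<phi> s) x + dist w y)"
    using T sT w \<open>x \<in> T\<close> \<open>y \<in> T\<close> unfolding four_point_condition_def by blast
  moreover have "dist w x = s" "dist (\<phi> s) x = s" "dist (\<phi> s) y = dist x y - s"
    "dist w y = dist x y - s"
    using d w by (simp_all add: dist_commute s_def)
  ultimately have "dist w (\<phi> s) \<le> 0" by auto
  then have "w = \<phi> s" by simp
  then show "w \<in> \<phi> ` {0..dist x y}" using s by blast
qed

lemma segment_eq:
  assumes T: "R_tree T" and xy: "x \<in> T" "y \<in> T"
  shows "segment T x y = {w\<in>T. dist x w + dist w y = dist x y}"
    and "isometric_path T \<phi> x y \<Longrightarrow> segment T x y = \<phi> ` {0..dist x y}"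
proof -
  have 4: "four_point_condition T" using T by (simp add: R_tree_def)
  obtain \<phi>0 where 0: "isometric_path T \<phi>0 x y"
    using T xy unfolding R_tree_def geodesic_set_def by blast
  show *: "segment T x y = {w\<in>T. dist x w + dist w y = dist x y}"
    unfolding segment_def using 0 isometric_path_image[OF 4 xy] by (intro the_equality) blast+
  show "segment T x y = \<phi> ` {0..dist x y}" if "isometric_path T \<phi> x y"
    using * isometric_path_image[OF 4 xy that] by simp
qed

lemma tree_conv_superset:
  assumes "R_tree T" "M \<subseteq> T"
  shows "M \<subseteq> tree_conv T M"
proof
  fix x assume "x \<in> M"
  then have "x \<in> segment T x x" using assms by (auto simp: segment_eq(1))
  then show "x \<in> tree_conv T M" using \<open>x \<in> M\<close> unfolding tree_conv_def by blast
qed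

lemma tree_conv_subset:
  assumes "R_tree T" "M \<subseteq> T"
  shows "tree_conv T M \<subseteq> T"
  unfolding tree_conv_def using assms by (auto simp: segment_eq(1) subset_iff)

lemma R_tree_tree_conv:
  assumes T: "R_tree T" and M: "M \<subseteq> T"
  shows "R_tree (tree_conv T M)"
proof -
  have sub: "tree_conv T M \<subseteq> T" by (rule tree_conv_subset[OF T M])
  have 4: "dist a b + dist c e \<le> max (dist a c + dist b e) (dist b c + dist a e)"
    if "a \<in> T" "b \<in> T" "c \<in> T" "e \<in> T" for a b c e
    using T that unfolding R_tree_def four_point_condition_def by blast
  have key: "dist x w + dist w q = dist x q \<or> dist y w + dist w q = dist y q"
    if "dist x p + dist p y = dist x y" "dist p w + dist w q = dist p q"
      "x \<in> T" "y \<in> T" "p \<in> T" "q \<in> T" for x y p q w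
    using 4[of x y p q] that dist_triangle[of x w p] dist_triangle[of y w p]
      dist_triangle[of x q w] dist_triangle[of y q w]
    by (auto simp: dist_commute max_def split: if_splits)
  have mem: "w \<in> tree_conv T M \<longleftrightarrow> w \<in> T \<and> (\<exists>x\<in>M. \<exists>y\<in>M. dist x w + dist w y = dist x y)" for w
    unfolding tree_conv_def using M by (auto simp: segment_eq(1)[OF T] subset_iff)
  have "\<exists>\<phi>. isometric_path (tree_conv T M) \<phi> p q"
    if pq: "p \<in> tree_conv T M" "q \<in> tree_conv T M" for p q
  proof -
    have pqT: "p \<in> T" "q \<in> T" using sub pq by auto
    obtain \<phi> where \<phi>: "isometric_path T \<phi> p q"
      using T pqT unfolding R_tree_def geodesic_set_def by blast
    have "w \<in> tree_conv T M" if "w \<in> \<phi> ` {0..dist p q}" for w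
    proof -
      have w: "w \<in> T" "dist p w + dist w q = dist p q"
        using segment_eq[OF T pqT] \<phi> that by auto
      obtain x y where xy: "x \<in> M" "y \<in> M" "dist x p + dist p y = dist x y" using pq mem by blast
      obtain u v where uv: "u \<in> M" "v \<in> M" "dist u q + dist q v = dist u v" using pq mem by blast
      obtain x' where x': "x' \<in> M" "dist x' w + dist w q = dist x' q"
        using key[OF xy(3) w(2)] xy M pqT by blast
      have "dist u w + dist w x' = dist u x' \<or> dist v w + dist w x' = dist v x'"
        using key[OF uv(3), of w x'] x' uv M pqT by (auto simp: dist_commute add.commute)
      then show ?thesis using mem w(1) x'(1) uv by blast
    qed
    then have "isometric_path (tree_conv T M) \<phi> p q" using \<phi> unfolding isometric_path_def by blast
    then show ?thesis by blast
  qed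
  moreover have "four_point_condition (tree_conv T M)"
    unfolding four_point_condition_def using 4 sub by blast
  ultimately show ?thesis unfolding R_tree_def geodesic_set_def by blast
qed


section \<open>Lipschitz functions and the Lipschitz-free space\<close>

text \<open>A function on \<open>M\<close> is represented by its extension by zero to the whole type, so that equality
  of representatives is equality on \<open>M\<close>; likewise a functional on \<open>Lip0 M z\<close> is extended by zero
  to all other arguments. The point \<open>z\<close> is the distinguished point of \<open>M\<close>.\<close>

definition Lip0 :: "'a::metric_space set \<Rightarrow> 'a \<Rightarrow> ('a \<Rightarrow> real) set" where
  "Lip0 M z = {f. (\<exists>L. L-lipschitz_on M f) \<and> f z = 0 \<and> (\<forall>x. x \<notin> M \<longrightarrow> f x = 0)}"

text \<open>Inserting \<open>0\<close> only matters when \<open>M\<close> has fewer than two points.\<close>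

definition lip_norm :: "'a::metric_space set \<Rightarrow> ('a \<Rightarrow> real) \<Rightarrow> real" where
  "lip_norm M f = Sup (insert 0 {(f x - f y) / dist x y | x y. x \<in> M \<and> y \<in> M \<and> x \<noteq> y})"

definition lip_ball :: "'a::metric_space set \<Rightarrow> 'a \<Rightarrow> ('a \<Rightarrow> real) set" where
  "lip_ball M z = {f \<in> Lip0 M z. lip_norm M f \<le> 1}"

definition lip_dual :: "'a::metric_space set \<Rightarrow> 'a \<Rightarrow> (('a \<Rightarrow> real) \<Rightarrow> real) set" where
  "lip_dual M z = {\<phi>.
     (\<forall>f\<in>Lip0 M z. \<forall>g\<in>Lip0 M z. \<phi> (f + g) = \<phi> f + \<phi> g) \<and>
     (\<forall>c. \<forall>f\<in>Lip0 M z. \<phi> (c *\<^sub>R f) = c * \<phi> f) \<and>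
     (\<exists>K. \<forall>f\<in>Lip0 M z. \<bar>\<phi> f\<bar> \<le> K * lip_norm M f) \<and>
     (\<forall>f. f \<notin> Lip0 M z \<longrightarrow> \<phi> f = 0)}"

definition dual_norm :: "'a::metric_space set \<Rightarrow> 'a \<Rightarrow> (('a \<Rightarrow> real) \<Rightarrow> real) \<Rightarrow> real" where
  "dual_norm M z \<phi> = (SUP f\<in>lip_ball M z. \<bar>\<phi> f\<bar>)"

definition delta :: "'a::metric_space set \<Rightarrow> 'a \<Rightarrow> 'a \<Rightarrow> ('a \<Rightarrow> real) \<Rightarrow> real" where
  "delta M z x = (\<lambda>f. if f \<in> Lip0 M z then f x else 0)"

text \<open>The closure is taken with respect to \<^const>\<open>dual_norm\<close>, not in the product topology that the
  library puts on function types.\<close>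

definition free_space :: "'a::metric_space set \<Rightarrow> 'a \<Rightarrow> (('a \<Rightarrow> real) \<Rightarrow> real) set" where
  "free_space M z = {\<phi> \<in> lip_dual M z.
     \<forall>\<epsilon>>0. \<exists>\<psi>\<in>span (delta M z ` M). dual_norm M z (\<phi> - \<psi>) < \<epsilon>}"

definition free_ball :: "'a::metric_space set \<Rightarrow> 'a \<Rightarrow> (('a \<Rightarrow> real) \<Rightarrow> real) set" where
  "free_ball M z = {\<phi> \<in> free_space M z. dual_norm M z \<phi> \<le> 1}"

lemma lip_norm_bound:
  assumes "f \<in> Lip0 M z" "x \<in> M" "y \<in> M"
  shows "\<bar>f x - f y\<bar> \<le> lip_norm M f * dist x y" and "0 \<le> lip_norm M f"
proof -
  obtain L where L: "L-lipschitz_on M f" using assms unfolding Lip0_def by blast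
  let ?Q = "insert 0 {(f x - f y) / dist x y | x y. x \<in> M \<and> y \<in> M \<and> x \<noteq> y}"
  have "r \<le> L" if "r \<in> ?Q" for r
  proof (cases "r = 0")
    case True
    then show ?thesis using lipschitz_on_nonneg[OF L] by simp
  next
    case False
    with that obtain u v where uv: "r = (f u - f v) / dist u v" "u \<in> M" "v \<in> M" "u \<noteq> v"
      by blast
    have "f u - f v \<le> L * dist u v"
      using lipschitz_onD[OF L uv(2,3)] by (simp add: dist_real_def)
    then show ?thesis using uv by (simp add: divide_le_eq)
  qed
  then have bdd: "bdd_above ?Q" by (rule bdd_aboveI)
  show "0 \<le> lip_norm M f" unfolding lip_norm_def by (rule cSup_upper[OF _ bdd]) simp
  have "f u - f v \<le> lip_norm M f * dist u v" if "u \<in> M" "v \<in> M" for u v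
  proof (cases "u = v")
    case False
    have "(f u - f v) / dist u v \<le> lip_norm M f"
      unfolding lip_norm_def using that False by (intro cSup_upper[OF _ bdd]) blast
    then show ?thesis using False by (simp add: divide_le_eq)
  qed simp
  from this[OF assms(2,3)] this[OF assms(3,2)]
  show "\<bar>f x - f y\<bar> \<le> lip_norm M f * dist x y" by (simp add: dist_commute abs_le_iff)
qed

lemma subspace_Lip0: "subspace (Lip0 M z)"
proof (rule subspaceI)
  show "0 \<in> Lip0 M z"
    unfolding Lip0_def using lipschitz_on_constant[of M "0::real"] by (auto simp: zero_fun_def)
  fix f g assume f: "f \<in> Lip0 M z" and g: "g \<in> Lip0 M z"
  show "f + g \<in> Lip0 M z"
    using f g lipschitz_on_add[of _ M f _ g] unfolding Lip0_def by (fastforce simp: plus_fun_def)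
next
  fix c :: real and f assume f: "f \<in> Lip0 M z"
  show "c *\<^sub>R f \<in> Lip0 M z"
    using f lipschitz_on_cmult_real[of _ M f c] unfolding Lip0_def
    by (fastforce simp: scaleR_fun_def)
qed

lemma delta_in_free_space:
  assumes "z \<in> M" "x \<in> M"
  shows "delta M z x \<in> free_space M z"
proof -
  have "\<bar>delta M z x f\<bar> \<le> dist x z * lip_norm M f" if "f \<in> Lip0 M z" for f
    using lip_norm_bound(1)[OF that assms(2,1)] that by (simp add: delta_def Lip0_def mult.commute)
  then have "delta M z x \<in> lip_dual M z"
    unfolding lip_dual_def
    by (auto simp: delta_def subspace_add[OF subspace_Lip0] subspace_scale[OF subspace_Lip0])
  moreover have "0 \<in> lip_ball M z"
    using subspace_0[OF subspace_Lip0, of M z]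
    by (auto simp: lip_ball_def lip_norm_def intro!: cSup_least)
  then have "lip_ball M z \<noteq> {}" by blast
  then have "dual_norm M z (delta M z x - delta M z x) = 0"
    by (simp add: dual_norm_def)
  moreover have "delta M z x \<in> span (delta M z ` M)" using assms by (simp add: span_base)
  ultimately show ?thesis unfolding free_space_def by force
qed

end

theory Submission
  imports Defs
begin

text \<open>Around \<open>b\<close> there is a tripod with ends \<open>x, y, w \<in> M\<close> and no further point of \<open>M\<close> on its legs.

  (a) If \<open>[x, y] \<inter> M = {x, y}\<close>, then the molecule \<open>(\<delta>\<^sub>x - \<delta>\<^sub>y) / d(x, y)\<close> is extreme: the distance
  \<open>f\<close> from \<open>y\<close> to the projection onto \<open>[x, y]\<close> is a norming function, and it stays norming after
  adding a small multiple of any Lipschitz function that vanishes near \<open>x\<close> and \<open>y\<close>; such functions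
  are weak* dense among those with equal values at \<open>x\<close> and \<open>y\<close>. Two molecules on the tripod that
  share the end \<open>x\<close> are at distance less than 2.

  (b) Let \<open>u\<close> be the position of the projection onto \<open>[x, y]\<close> and \<open>h\<close> the height over it. The function
  \<open>\<bar>u - t\<bar> - h\<close> is extreme as soon as \<open>t\<close> lies in the closure of \<open>u(M)\<close>. This applies to the position
  of \<open>b\<close>, because of the end \<open>w\<close>, and to a suitable position close to it or next to it; the two
  functions differ only along a piece of \<open>[x, y]\<close> that no pair in \<open>M\<close> approximates.\<close>

section \<open>Gromov products in trees\<close>

text \<open>The value 0 says that \<open>p\<close> lies metrically between \<open>v\<close> and
  \<open>w\<close>; this is how different directions at a branching point are expressed
  below.\<close>

definition gromov_product :: "'a::metric_space \<Rightarrow> 'a \<Rightarrow> 'a \<Rightarrow> real" where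
  "gromov_product p v w = (dist p v + dist p w - dist v w) / 2"

lemma gromov_product_commute: "gromov_product p v w = gromov_product p w v"
  by (simp add: gromov_product_def dist_commute)

lemma gromov_product_nonneg: "0 \<le> gromov_product p v w"
  using dist_triangle[of v w p] by (simp add: gromov_product_def dist_commute)

lemma gromov_product_lipschitz: "\<bar>gromov_product p q v - gromov_product p q w\<bar> \<le> dist v w"
  using dist_triangle[of p v w] dist_triangle[of p w v]
    dist_triangle[of q v w] dist_triangle[of q w v]
  by (simp add: gromov_product_def dist_commute abs_le_iff field_simps)

lemma four_point:
  assumes "R_tree T" "a \<in> T" "b \<in> T" "c \<in> T" "e \<in> T"
  shows "dist a b + dist c e \<le> max (dist a c + dist b e) (dist b c + dist a e)"
  using assms unfolding R_tree_def four_point_condition_def by blast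

text \<open>In a tree, \<open>gromov_product x y w\<close> is the distance from \<open>x\<close> to the projection of \<open>w\<close> onto
  the segment \<open>[x, y]\<close>, and \<open>gromov_product w x y\<close> is the distance from \<open>w\<close> to that projection.\<close>

lemma dist_ge_through_projections:
  assumes "R_tree T" "x \<in> T" "y \<in> T" "v \<in> T" "w \<in> T"
    and "gromov_product x y v \<noteq> gromov_product x y w"
  shows "\<bar>gromov_product x y v - gromov_product x y w\<bar> + gromov_product v x y
           + gromov_product w x y \<le> dist v w"
  using four_point[OF assms(1), of v x w y] four_point[OF assms(1), of w x v y] assms(2-)
  by (auto simp: gromov_product_def dist_commute abs_if max_def field_simps split: if_splits)

text \<open>The path from \<open>w\<close> to \<open>p\<close> descends to the projection of
  \<open>w\<close> and then follows the segment.\<close>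

lemma dist_point_of_segment_le:
  assumes "R_tree T" "x \<in> T" "y \<in> T" "p \<in> T" "w \<in> T" "dist x p + dist p y = dist x y"
  shows "dist w p \<le> \<bar>gromov_product x y w - dist x p\<bar> + gromov_product w x y"
  using four_point[OF assms(1), of w p x y] assms(2-)
  by (auto simp: gromov_product_def dist_commute abs_if max_def field_simps split: if_splits)

text \<open>In a tree, Gromov products based at \<open>b\<close> satisfy the ultrametric inequality:
  the smaller of the products of \<open>x, x'\<close> and of \<open>x', y\<close> is at most that of
  \<open>x, y\<close>, which is 0.\<close>

lemma gromov_product_eq_0_same_direction:
  assumes "R_tree T" "b \<in> T" "x \<in> T" "y \<in> T" "x' \<in> T"
    and "gromov_product b x y = 0" "0 < gromov_product b x x'"
  shows "gromov_product b x' y = 0"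
  using four_point[OF assms(1), of b x' x y] four_point[OF assms(1), of x y b x'] assms(2-)
    gromov_product_nonneg[of b x' y]
  by (auto simp: gromov_product_def dist_commute max_def split: if_splits)

section \<open>Points on segments and tripods\<close>

lemma R_tree_point_at:
  assumes "R_tree T" "x \<in> T" "y \<in> T" "0 \<le> s" "s \<le> dist x y"
  obtains p where "p \<in> T" "dist x p = s" "dist p y = dist x y - s"
proof -
  obtain \<phi> where \<phi>: "isometric_path T \<phi> x y"
    using assms unfolding R_tree_def geodesic_set_def by blast
  then have ends: "\<phi> 0 = x" "\<phi> (dist x y) = y" and "\<phi> s \<in> T"
    and iso: "\<forall>s\<in>{0..dist x y}. \<forall>t\<in>{0..dist x y}. dist (\<phi> s) (\<phi> t) = \<bar>s - t\<bar>"
    using assms unfolding isometric_path_def by auto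
  moreover have "dist x (\<phi> s) = s" "dist (\<phi> s) y = dist x y - s"
    using iso[rule_format, of 0 s] iso[rule_format, of s "dist x y"] assms(4,5)
    unfolding ends by simp_all
  ultimately show thesis using that by blast
qed

lemma compact_segment:
  assumes "R_tree T" "x \<in> T" "y \<in> T"
  shows "compact {w\<in>T. dist x w + dist w y = dist x y}"
proof -
  obtain \<phi> where \<phi>: "isometric_path T \<phi> x y"
    using assms unfolding R_tree_def geodesic_set_def by blast
  then have "1-lipschitz_on {0..dist x y} \<phi>"
    unfolding isometric_path_def by (intro lipschitz_onI) (auto simp: dist_real_def)
  then have "compact (\<phi> ` {0..dist x y})"
    by (intro compact_continuous_image lipschitz_on_continuous_on compact_Icc)
  then show ?thesis
    using isometric_path_image[OF _ assms(2,3) \<phi>] assms(1) by (simp add: R_tree_def)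
qed

text \<open>The geodesics from \<open>b\<close> to \<open>x\<close> and to \<open>y\<close> run
  together for the length of the Gromov product, so the point of \<open>[b, x]\<close> at that
  distance from \<open>b\<close> lies on both segments and must be \<open>b\<close>.\<close>

lemma disjoint_segments_gromov_product:
  assumes T: "R_tree T" and xyb: "x \<in> T" "y \<in> T" "b \<in> T"
    and disj: "segment T x b \<inter> segment T y b = {b}"
  shows "gromov_product b x y = 0"
proof -
  let ?m = "gromov_product b x y"
  have "?m \<le> dist b x"
    using dist_triangle[of b y x] by (simp add: gromov_product_def dist_commute)
  then obtain w where w: "w \<in> T" "dist b w = ?m" "dist w x = dist b x - ?m"
    using R_tree_point_at[OF T xyb(3,1) gromov_product_nonneg] by blast
  have "dist y w \<le> \<bar>gromov_product b x y - dist b w\<bar> + gromov_product y b x"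
    by (rule dist_point_of_segment_le[OF T]) (use w xyb in auto)
  then have "dist y w + dist w b \<le> dist y b"
    using w(2) by (simp add: gromov_product_def dist_commute field_simps)
  then have "w \<in> segment T x b \<inter> segment T y b"
    using w dist_triangle[of y b w] by (simp add: segment_eq(1)[OF T] xyb dist_commute)
  then have "w = b" using disj by blast
  then show ?thesis using w(2) by simp
qed

text \<open>Each of the three directions at the branching point contains a point of \<open>M\<close>, and the first
  point of \<open>M\<close> met on the way from \<open>b\<close> is such that nothing of \<open>M\<close> lies before it.\<close>

lemma branching_point_tripod:
  assumes T: "R_tree T" and M: "M \<subseteq> T" "closed M" and b: "b \<in> Br T M" "b \<notin> M"
  obtains x y w where "x \<in> M" "y \<in> M" "w \<in> M"
    "gromov_product b x y = 0" "gromov_product b x w = 0" "gromov_product b y w = 0"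
    "\<forall>p\<in>{x, y, w}. \<forall>v\<in>M. dist p v + dist v b = dist p b \<longrightarrow> v = p"
proof -
  define C where "C = tree_conv T M"
  have C: "R_tree C" "C \<subseteq> T"
    unfolding C_def using R_tree_tree_conv[OF T M(1)] tree_conv_subset[OF T M(1)] by auto
  have bp: "branching_point C b" using b unfolding Br_def C_def by simp
  then have bC: "b \<in> C" by (simp add: branching_point_def)
  then have bT: "b \<in> T" using C by blast
  have near: "\<exists>p\<in>M. 0 < gromov_product b x p \<and>
      (\<forall>v\<in>M. dist p v + dist v b = dist p b \<longrightarrow> v = p)" if x: "x \<in> C" "x \<noteq> b" for x
  proof -
    have xT: "x \<in> T" using x C by blast
    obtain p q where pq: "p \<in> M" "q \<in> M" "x \<in> segment T p q"
      using x unfolding C_def tree_conv_def by blast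
    have pqT: "p \<in> T" "q \<in> T" using pq M by auto
    have "dist p x + dist x q = dist p q" using pq pqT by (simp add: segment_eq(1)[OF T])
    \<comment> \<open>As \<open>x\<close> lies between \<open>p\<close> and \<open>q\<close>, the
      four-point condition puts it on the way from \<open>b\<close> to at least one of them.\<close>
    then have "dist p x + dist x b = dist p b \<or> dist q x + dist x b = dist q b"
      using four_point[OF T pqT xT bT] dist_triangle[of p b x] dist_triangle[of q b x]
      by (auto simp: dist_commute max_def split: if_splits)
    then obtain p' where p': "p' \<in> M" "dist p' x + dist x b = dist p' b" using pq by blast
    have p'T: "p' \<in> T" using p' M by blast
    let ?S = "{w\<in>T. dist p' w + dist w b = dist p' b} \<inter> M"
    have "compact ?S" using compact_segment[OF T p'T bT] M(2) by (rule compact_Int_closed)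
    moreover have "p' \<in> ?S" using p' p'T by simp
    moreover have "continuous_on ?S (\<lambda>w. dist w b)" by (intro continuous_intros)
    ultimately obtain p where p: "p \<in> ?S" "\<forall>v\<in>?S. dist p b \<le> dist v b"
      using continuous_attains_inf[of ?S "\<lambda>w. dist w b"] by blast
    have "v = p" if v: "v \<in> M" "dist p v + dist v b = dist p b" for v
    proof -
      have "dist p' v + dist v b = dist p' b"
        using v p dist_triangle[of p' v p] dist_triangle[of p' b v] by auto
      then have "dist p b \<le> dist v b" using p v M by auto
      then have "dist p v \<le> 0" using v(2) by linarith
      then show ?thesis by simp
    qed
    \<comment> \<open>Both \<open>x\<close> and \<open>p\<close> lie between \<open>b\<close> and
      \<open>p'\<close>, so the ultrametric inequality bounds their product below by the smaller of
      their distances to \<open>b\<close>.\<close>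
    moreover have "0 < gromov_product b x p"
    proof -
      have "p \<noteq> b" using p b by auto
      have "gromov_product b x p' = dist b x" "gromov_product b p' p = dist b p"
        using p' p by (auto simp: gromov_product_def dist_commute)
      moreover have "min (gromov_product b x p') (gromov_product b p' p) \<le> gromov_product b x p"
        using four_point[OF T xT _ bT p'T, of p] p M
        by (auto simp: gromov_product_def dist_commute max_def min_def split: if_splits)
      moreover have "0 < dist b x" "0 < dist b p" using \<open>p \<noteq> b\<close> \<open>x \<noteq> b\<close> by auto
      ultimately show ?thesis by linarith
    qed
    ultimately show ?thesis using p by blast
  qed
  have zero: "gromov_product b p q = 0"
    if "x \<in> C" "y \<in> C" "gromov_product b x y = 0" "p \<in> M" "q \<in> M"
      "0 < gromov_product b x p" "0 < gromov_product b y q" for x y p q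
  proof -
    have TT: "x \<in> T" "y \<in> T" "p \<in> T" "q \<in> T" using that C M by auto
    \<comment> \<open>The ends are exchanged for points of \<open>M\<close> one at a time.\<close>
    have "gromov_product b p y = 0"
      by (rule gromov_product_eq_0_same_direction[OF T bT TT(1,2,3)]) (use that in auto)
    then have "gromov_product b q p = 0"
      by (intro gromov_product_eq_0_same_direction[OF T bT TT(2,3,4)])
        (use that in \<open>auto simp: gromov_product_commute\<close>)
    then show ?thesis by (simp add: gromov_product_commute)
  qed
  obtain x y w where xyw: "x \<in> C" "y \<in> C" "w \<in> C" "x \<noteq> b" "y \<noteq> b" "w \<noteq> b"
    "segment C x b \<inter> segment C y b = {b}" "segment C x b \<inter> segment C w b = {b}"
    "segment C y b \<inter> segment C w b = {b}"
    using bp unfolding branching_point_def by auto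
  obtain p where p: "p \<in> M" "0 < gromov_product b x p"
    "\<forall>v\<in>M. dist p v + dist v b = dist p b \<longrightarrow> v = p" using near xyw by blast
  obtain q where q: "q \<in> M" "0 < gromov_product b y q"
    "\<forall>v\<in>M. dist q v + dist v b = dist q b \<longrightarrow> v = q" using near xyw by blast
  obtain o' where o': "o' \<in> M" "0 < gromov_product b w o'"
    "\<forall>v\<in>M. dist o' v + dist v b = dist o' b \<longrightarrow> v = o'" using near xyw by blast
  have g0: "gromov_product b x y = 0" "gromov_product b x w = 0" "gromov_product b y w = 0"
    using disjoint_segments_gromov_product[OF C(1) _ _ bC] xyw by auto
  show thesis
  proof (rule that[OF p(1) q(1) o'(1)])
    show "gromov_product b p q = 0" by (rule zero[OF xyw(1,2) g0(1) p(1) q(1) p(2) q(2)])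
    show "gromov_product b p o' = 0" by (rule zero[OF xyw(1,3) g0(2) p(1) o'(1) p(2) o'(2)])
    show "gromov_product b q o' = 0" by (rule zero[OF xyw(2,3) g0(3) q(1) o'(1) q(2) o'(2)])
    show "\<forall>p'\<in>{p, q, o'}. \<forall>v\<in>M. dist p' v + dist v b = dist p' b \<longrightarrow> v = p'"
      using p(3) q(3) o'(3) by blast
  qed
qed

text \<open>Since \<open>b\<close> lies on \<open>[x, y]\<close>, this segment is made up of
  \<open>[x, b]\<close> and \<open>[b, y]\<close>, and each half is covered by one of the last two
  hypotheses.\<close>

lemma tripod_segment_disjoint:
  assumes T: "R_tree T" and "x \<in> T" "y \<in> T" "b \<in> T" "v \<in> T"
    and "gromov_product b x y = 0" "dist x v + dist v y = dist x y"
    and "dist x v + dist v b = dist x b \<Longrightarrow> v = x" "dist y v + dist v b = dist y b \<Longrightarrow> v = y"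
  shows "v = x \<or> v = y"
proof -
  have "dist x v + dist v b = dist x b \<or> dist y v + dist v b = dist y b"
    using four_point[OF T, of v b x y] assms(2-7) dist_triangle[of x b v] dist_triangle[of y b v]
    by (auto simp: gromov_product_def dist_commute max_def split: if_splits)
  then show ?thesis using assms(8,9) by blast
qed

section \<open>Norms of Lipschitz functions and of functionals\<close>

text \<open>Subtracting a constant keeps all increments on \<open>M\<close>, so functions can be
  built without regard to their value at the distinguished point.\<close>

definition rebase :: "'a::metric_space set \<Rightarrow> 'a \<Rightarrow> ('a \<Rightarrow> real) \<Rightarrow> 'a \<Rightarrow> real" where
  "rebase M z g = (\<lambda>w. if w \<in> M then g w - g z else 0)"

lemma lip_norm_le:
  assumes "0 \<le> L" "\<And>v w. v \<in> M \<Longrightarrow> w \<in> M \<Longrightarrow> f v - f w \<le> L * dist v w"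
  shows "lip_norm M f \<le> L"
  unfolding lip_norm_def using assms by (intro cSup_least) (auto simp: divide_le_eq)

lemma rebase_in_Lip0:
  assumes "0 \<le> L" "\<And>v w. v \<in> M \<Longrightarrow> w \<in> M \<Longrightarrow> \<bar>g v - g w\<bar> \<le> L * dist v w"
  shows "rebase M z g \<in> Lip0 M z" and "lip_norm M (rebase M z g) \<le> L"
proof -
  have "L-lipschitz_on M (rebase M z g)"
    using assms by (intro lipschitz_onI) (auto simp: rebase_def dist_real_def)
  then show "rebase M z g \<in> Lip0 M z" unfolding Lip0_def by (auto simp: rebase_def)
  show "lip_norm M (rebase M z g) \<le> L"
    using assms by (intro lip_norm_le) (auto simp: rebase_def abs_le_iff)
qed

lemma zero_in_lip_ball: "0 \<in> lip_ball M z"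
  using subspace_0[OF subspace_Lip0, of M z] by (auto simp: lip_ball_def intro!: lip_norm_le)

lemma lip_norm_scale_le:
  assumes "f \<in> Lip0 M z" "z \<in> M"
  shows "lip_norm M (c *\<^sub>R f) \<le> \<bar>c\<bar> * lip_norm M f"
proof (rule lip_norm_le)
  show "0 \<le> \<bar>c\<bar> * lip_norm M f" using lip_norm_bound(2)[OF assms(1,2,2)] by simp
  fix v w assume "v \<in> M" "w \<in> M"
  then have "\<bar>c\<bar> * \<bar>f v - f w\<bar> \<le> \<bar>c\<bar> * (lip_norm M f * dist v w)"
    by (intro mult_left_mono lip_norm_bound(1)[OF assms(1)]) auto
  then show "(c *\<^sub>R f) v - (c *\<^sub>R f) w \<le> \<bar>c\<bar> * lip_norm M f * dist v w"
    by (simp add: abs_mult[symmetric] right_diff_distrib mult.assoc)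
qed

lemma subspace_lip_dual: "subspace (lip_dual M z)"
proof (rule subspaceI)
  show "0 \<in> lip_dual M z" unfolding lip_dual_def by (auto intro!: exI[of _ 0])
next
  fix \<phi> \<psi> assume \<phi>: "\<phi> \<in> lip_dual M z" and \<psi>: "\<psi> \<in> lip_dual M z"
  obtain K where K: "\<forall>f\<in>Lip0 M z. \<bar>\<phi> f\<bar> \<le> K * lip_norm M f" using \<phi> unfolding lip_dual_def by blast
  obtain L where L: "\<forall>f\<in>Lip0 M z. \<bar>\<psi> f\<bar> \<le> L * lip_norm M f" using \<psi> unfolding lip_dual_def by blast
  have "\<forall>f\<in>Lip0 M z. \<bar>(\<phi> + \<psi>) f\<bar> \<le> (K + L) * lip_norm M f"
  proof
    fix f assume "f \<in> Lip0 M z"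
    then show "\<bar>(\<phi> + \<psi>) f\<bar> \<le> (K + L) * lip_norm M f"
      using bspec[OF K, of f] bspec[OF L, of f] abs_triangle_ineq[of "\<phi> f" "\<psi> f"]
      by (simp add: distrib_right)
  qed
  then show "\<phi> + \<psi> \<in> lip_dual M z" using \<phi> \<psi> unfolding lip_dual_def
    by (auto simp: distrib_left)
next
  fix c and \<phi> assume \<phi>: "\<phi> \<in> lip_dual M z"
  obtain K where K: "\<forall>f\<in>Lip0 M z. \<bar>\<phi> f\<bar> \<le> K * lip_norm M f" using \<phi> unfolding lip_dual_def by blast
  have "\<forall>f\<in>Lip0 M z. \<bar>(c *\<^sub>R \<phi>) f\<bar> \<le> (\<bar>c\<bar> * K) * lip_norm M f"
    using K by (auto simp: abs_mult mult.assoc intro!: mult_left_mono)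
  then show "c *\<^sub>R \<phi> \<in> lip_dual M z" using \<phi> unfolding lip_dual_def
    by (auto simp: distrib_left)
qed

lemma dual_norm_bound:
  assumes \<phi>: "\<phi> \<in> lip_dual M z" and f: "f \<in> Lip0 M z" and z: "z \<in> M"
  shows "\<bar>\<phi> f\<bar> \<le> dual_norm M z \<phi> * lip_norm M f"
proof -
  obtain K where K: "\<forall>f\<in>Lip0 M z. \<bar>\<phi> f\<bar> \<le> K * lip_norm M f" using \<phi> unfolding lip_dual_def by blast
  have bdd: "bdd_above ((\<lambda>f. \<bar>\<phi> f\<bar>) ` lip_ball M z)"
  proof (rule bdd_aboveI2)
    fix g assume "g \<in> lip_ball M z"
    then have g: "g \<in> Lip0 M z" "lip_norm M g \<le> 1" by (auto simp: lip_ball_def)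
    have "\<bar>\<phi> g\<bar> \<le> K * lip_norm M g" using K g by blast
    also have "\<dots> \<le> \<bar>K\<bar> * 1"
      using g lip_norm_bound(2)[OF g(1) z z] by (intro mult_mono) auto
    finally show "\<bar>\<phi> g\<bar> \<le> \<bar>K\<bar>" by simp
  qed
  define n where "n = lip_norm M f"
  have n0: "0 \<le> n" unfolding n_def by (rule lip_norm_bound(2)[OF f z z])
  show ?thesis
  proof (cases "n = 0")
    case True
    then show ?thesis using K f unfolding n_def by fastforce
  next
    case False
    then have n: "0 < n" using n0 by simp
    have "lip_norm M ((1 / n) *\<^sub>R f) \<le> \<bar>1 / n\<bar> * n"
      unfolding n_def by (rule lip_norm_scale_le[OF f z])
    then have "(1 / n) *\<^sub>R f \<in> lip_ball M z"
      using n f subspace_scale[OF subspace_Lip0] by (simp add: lip_ball_def)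
    then have "\<bar>\<phi> ((1 / n) *\<^sub>R f)\<bar> \<le> dual_norm M z \<phi>"
      unfolding dual_norm_def by (rule cSUP_upper[OF _ bdd])
    moreover have "\<phi> ((1 / n) *\<^sub>R f) = (1 / n) * \<phi> f" using \<phi> f unfolding lip_dual_def by blast
    ultimately show ?thesis using n unfolding n_def[symmetric] by (simp add: abs_mult field_simps)
  qed
qed

lemma dual_norm_le:
  assumes "\<And>f. f \<in> lip_ball M z \<Longrightarrow> \<bar>\<phi> f\<bar> \<le> C"
  shows "dual_norm M z \<phi> \<le> C"
  unfolding dual_norm_def using assms zero_in_lip_ball by (intro cSUP_least) auto

text \<open>A finite combination of evaluations is bounded in the uniform norm by the sum of the
  absolute values of its coefficients.\<close>

lemma span_delta_bound:
  assumes "\<psi> \<in> span (delta M z ` M)"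
  shows "\<exists>C\<ge>0. \<forall>f\<in>Lip0 M z. \<forall>\<epsilon>. (\<forall>w\<in>M. \<bar>f w\<bar> \<le> \<epsilon>) \<longrightarrow> \<bar>\<psi> f\<bar> \<le> C * \<epsilon>"
  using assms
proof (induction rule: span_induct_alt)
  case base
  show ?case by (auto intro!: exI[of _ 0])
next
  case (step c x y)
  then obtain C where C: "C \<ge> 0" "\<forall>f\<in>Lip0 M z. \<forall>\<epsilon>. (\<forall>w\<in>M. \<bar>f w\<bar> \<le> \<epsilon>) \<longrightarrow> \<bar>y f\<bar> \<le> C * \<epsilon>" by blast
  obtain p where p: "p \<in> M" "x = delta M z p" using step by blast
  have "\<bar>(c *\<^sub>R x + y) f\<bar> \<le> (\<bar>c\<bar> + C) * \<epsilon>"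
    if f: "f \<in> Lip0 M z" "\<forall>w\<in>M. \<bar>f w\<bar> \<le> \<epsilon>" for f \<epsilon>
  proof -
    have "\<bar>c * f p\<bar> \<le> \<bar>c\<bar> * \<epsilon>" using p f by (auto simp: abs_mult intro!: mult_left_mono)
    moreover have "\<bar>y f\<bar> \<le> C * \<epsilon>" using C f by blast
    ultimately show ?thesis
      using f abs_triangle_ineq[of "c * f p" "y f"] by (simp add: p delta_def distrib_right)
  qed
  then show ?case using C(1) by (intro exI[of _ "\<bar>c\<bar> + C"]) auto
qed

lemma span_delta_subset_lip_dual: "z \<in> M \<Longrightarrow> span (delta M z ` M) \<subseteq> lip_dual M z"
  using delta_in_free_space by (intro span_minimal subspace_lip_dual) (auto simp: free_space_def)

text \<open>Elements of the free space are weak* continuous on bounded sets.\<close>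

lemma free_space_eq_0:
  assumes \<mu>: "\<mu> \<in> free_space M z" and z: "z \<in> M" and k: "k \<in> Lip0 M z"
    and approx: "\<And>\<epsilon>. 0 < \<epsilon> \<Longrightarrow>
      \<exists>h\<in>Lip0 M z. lip_norm M (k - h) \<le> L \<and> (\<forall>w\<in>M. \<bar>k w - h w\<bar> \<le> \<epsilon>) \<and> \<mu> h = 0"
  shows "\<mu> k = 0"
proof -
  have \<mu>d: "\<mu> \<in> lip_dual M z" using \<mu> by (simp add: free_space_def)
  have L: "0 \<le> L"
    using approx[of 1] lip_norm_bound(2)[OF subspace_diff[OF subspace_Lip0 k] z z]
    by (force intro: order_trans)
  have "\<bar>\<mu> k\<bar> \<le> \<eta>" if \<eta>: "0 < \<eta>" for \<eta>
  proof -
    \<comment> \<open>\<open>\<psi>\<close> sees only the uniform size of \<open>k - h\<close>, and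
      \<open>\<mu> - \<psi>\<close> only its Lipschitz norm; each part gets half of
      \<open>\<eta>\<close>. The bound \<open>\<epsilon>\<close> is chosen after
      \<open>\<psi>\<close>, as it depends on \<open>C\<close>.\<close>
    define \<eta>' where "\<eta>' = \<eta> / (2 * (L + 1))"
    have \<eta>': "0 < \<eta>'" "\<eta>' * L \<le> \<eta> / 2" using \<eta> L by (auto simp: \<eta>'_def field_simps)
    obtain \<psi> where \<psi>: "\<psi> \<in> span (delta M z ` M)" "dual_norm M z (\<mu> - \<psi>) < \<eta>'"
      using \<mu> \<eta>' unfolding free_space_def by blast
    obtain C where C: "C \<ge> 0" "\<forall>f\<in>Lip0 M z. \<forall>\<epsilon>. (\<forall>w\<in>M. \<bar>f w\<bar> \<le> \<epsilon>) \<longrightarrow> \<bar>\<psi> f\<bar> \<le> C * \<epsilon>"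
      using span_delta_bound[OF \<psi>(1)] by blast
    define \<epsilon> where "\<epsilon> = \<eta> / (2 * (C + 1))"
    have \<epsilon>: "0 < \<epsilon>" "C * \<epsilon> \<le> \<eta> / 2" using \<eta> C(1) by (auto simp: \<epsilon>_def field_simps)
    obtain h where h: "h \<in> Lip0 M z" "lip_norm M (k - h) \<le> L"
      "\<forall>w\<in>M. \<bar>k w - h w\<bar> \<le> \<epsilon>" "\<mu> h = 0" using approx[OF \<epsilon>(1)] by blast
    have kh: "k - h \<in> Lip0 M z" by (rule subspace_diff[OF subspace_Lip0 k h(1)])
    have "\<mu> ((k - h) + h) = \<mu> (k - h) + \<mu> h" using \<mu>d kh h(1) unfolding lip_dual_def by blast
    then have "\<mu> k = \<mu> (k - h)" using h(4) by simp
    moreover have "\<bar>\<psi> (k - h)\<bar> \<le> C * \<epsilon>" using C kh h(3) by simp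
    moreover have "\<bar>(\<mu> - \<psi>) (k - h)\<bar> \<le> \<eta>' * L"
    proof -
      have "\<mu> - \<psi> \<in> lip_dual M z"
        using \<mu>d \<psi>(1) span_delta_subset_lip_dual[OF z] subspace_diff[OF subspace_lip_dual] by blast
      then have "\<bar>(\<mu> - \<psi>) (k - h)\<bar> \<le> dual_norm M z (\<mu> - \<psi>) * lip_norm M (k - h)"
        by (rule dual_norm_bound[OF _ kh z])
      also have "\<dots> \<le> \<eta>' * L"
        using \<psi>(2) h(2) \<eta>'(1) lip_norm_bound(2)[OF kh z z] by (intro mult_mono) auto
      finally show ?thesis .
    qed
    ultimately show ?thesis using \<epsilon> \<eta>' by simp
  qed
  then show ?thesis using field_le_epsilon[of "\<bar>\<mu> k\<bar>" 0] by simp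
qed

section \<open>Molecules\<close>

definition molecule :: "'a::metric_space set \<Rightarrow> 'a \<Rightarrow> 'a \<Rightarrow> 'a \<Rightarrow> ('a \<Rightarrow> real) \<Rightarrow> real" where
  "molecule M z x y = (1 / dist x y) *\<^sub>R (delta M z x - delta M z y)"

lemma molecule_apply: "f \<in> Lip0 M z \<Longrightarrow> molecule M z x y f = (f x - f y) / dist x y"
  by (simp add: molecule_def delta_def)

lemma molecule_in_free_ball:
  assumes "z \<in> M" "x \<in> M" "y \<in> M"
  shows "molecule M z x y \<in> free_ball M z"
proof -
  have span: "molecule M z x y \<in> span (delta M z ` M)"
    unfolding molecule_def using assms by (intro span_scale span_diff span_base) auto
  have "dual_norm M z (molecule M z x y - molecule M z x y) \<le> 0"
    by (rule dual_norm_le) simp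
  then have "molecule M z x y \<in> free_space M z"
    unfolding free_space_def using span span_delta_subset_lip_dual[OF assms(1)]
    by (auto intro!: bexI[OF _ span])
  moreover have "dual_norm M z (molecule M z x y) \<le> 1"
  proof (rule dual_norm_le)
    fix f assume "f \<in> lip_ball M z"
    then have f: "f \<in> Lip0 M z" "lip_norm M f \<le> 1" by (auto simp: lip_ball_def)
    have "\<bar>f x - f y\<bar> \<le> lip_norm M f * dist x y" by (rule lip_norm_bound(1)[OF f(1) assms(2,3)])
    also have "\<dots> \<le> 1 * dist x y" using f(2) by (rule mult_right_mono) simp
    finally show "\<bar>molecule M z x y f\<bar> \<le> 1" by (simp add: molecule_apply[OF f(1)] divide_le_eq)
  qed
  ultimately show ?thesis by (simp add: free_ball_def)
qed

section \<open>Heights over a segment that meets \<open>M\<close> only at its ends\<close>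

lemma compact_closed_separated:
  fixes K M :: "'a::metric_space set"
  assumes "compact K" "closed M" "K \<inter> M = {}"
  obtains d where "0 < d" "\<forall>p\<in>K. \<forall>w\<in>M. d \<le> dist p w"
proof (cases "K = {} \<or> M = {}")
  \<comment> \<open>\<open>infdist\<close> to the empty set is 0, and an empty \<open>K\<close> has
    no minimiser, so any positive bound is chosen here.\<close>
  case True
  then show thesis using that[of 1] by auto
next
  case False
  then obtain p where p: "p \<in> K" "\<forall>q\<in>K. infdist p M \<le> infdist q M"
    using continuous_attains_inf[OF assms(1), of "\<lambda>p. infdist p M"]
      continuous_on_infdist[OF continuous_on_id] by blast
  show thesis
  proof (rule that)
    show "0 < infdist p M"
      using infdist_pos_not_in_closed[OF assms(2)] p(1) assms(3) False by blast
    show "\<forall>q\<in>K. \<forall>w\<in>M. infdist p M \<le> dist q w"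
      using p(2) infdist_le by (blast intro: order_trans)
  qed
qed

text \<open>The part of the segment away from its ends is compact and misses \<open>M\<close>, hence
  has positive distance from \<open>M\<close>; a point of \<open>M\<close> with very small height
  would be too close to its projection there.\<close>

lemma segment_interior_separated:
  assumes T: "R_tree T" and M: "M \<subseteq> T" "closed M" and xy: "x \<in> T" "y \<in> T"
    and free: "\<And>w. w \<in> M \<Longrightarrow> dist x w + dist w y = dist x y \<Longrightarrow> w = x \<or> w = y"
    and \<delta>: "0 < \<delta>"
  obtains \<rho> where "0 < \<rho>"
    "\<And>w. w \<in> M \<Longrightarrow> \<delta> \<le> dist w x \<Longrightarrow> \<delta> \<le> dist w y \<Longrightarrow> \<rho> \<le> gromov_product w x y"
proof -
  let ?S = "{w\<in>T. dist x w + dist w y = dist x y}"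
  \<comment> \<open>Half of \<open>\<delta>\<close> is left for the passage from \<open>w\<close> to
    its projection, which is allowed to come closer to the ends.\<close>
  define K where "K = ?S \<inter> {p. \<delta> / 2 \<le> dist p x} \<inter> {p. \<delta> / 2 \<le> dist p y}"
  have "compact K" unfolding K_def
    by (intro compact_Int_closed compact_segment[OF T xy] closed_Collect_le continuous_intros)
  moreover have "K \<inter> M = {}" using free \<delta> by (fastforce simp: K_def)
  ultimately obtain d where d: "0 < d" "\<forall>p\<in>K. \<forall>w\<in>M. d \<le> dist p w"
    using compact_closed_separated M(2) by blast
  show thesis
  proof (rule that[of "min d (\<delta> / 2)"])
    show "0 < min d (\<delta> / 2)" using d \<delta> by simp
    fix w assume w: "w \<in> M" "\<delta> \<le> dist w x" "\<delta> \<le> dist w y"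
    show "min d (\<delta> / 2) \<le> gromov_product w x y"
    proof (rule ccontr)
      assume "\<not> ?thesis"
      then have less: "gromov_product w x y < d" "gromov_product w x y < \<delta> / 2" by auto
      have "gromov_product x y w \<le> dist x y"
        using dist_triangle[of x w y] by (simp add: gromov_product_def dist_commute)
      then obtain p where p: "p \<in> T" "dist x p = gromov_product x y w"
          "dist p y = dist x y - gromov_product x y w"
        using R_tree_point_at[OF T xy gromov_product_nonneg] by blast
      have "dist w p \<le> gromov_product w x y"
        using dist_point_of_segment_le[OF T xy p(1), of w] w(1) M p(2,3) by auto
      then have wp: "dist w p < d" "dist w p < \<delta> / 2" using less by auto
      then have "p \<in> K"
        using p w dist_triangle[of w x p] dist_triangle[of w y p] by (simp add: K_def dist_commute)
      then have "d \<le> dist p w" using d(2) w(1) by blast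
      then show False using wp(1) by (simp add: dist_commute)
    qed
  qed
qed

text \<open>This moves \<open>r\<close> towards 0 by at most \<open>\<epsilon>\<close>. It cuts a
  Lipschitz function off near its zeros at uniform cost \<open>\<epsilon>\<close> without enlarging
  the Lipschitz constant.\<close>

definition soft_threshold :: "real \<Rightarrow> real \<Rightarrow> real" where
  "soft_threshold \<epsilon> r = r - max (- \<epsilon>) (min \<epsilon> r)"

lemma soft_threshold_props:
  assumes "0 < \<epsilon>"
  shows "\<bar>soft_threshold \<epsilon> r - soft_threshold \<epsilon> s\<bar> \<le> \<bar>r - s\<bar>"
    and "\<bar>r - soft_threshold \<epsilon> r\<bar> \<le> \<epsilon>"
    and "\<bar>r\<bar> \<le> \<epsilon> \<Longrightarrow> soft_threshold \<epsilon> r = 0"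
    and "\<bar>soft_threshold \<epsilon> r\<bar> \<le> \<bar>r\<bar>"
  using assms by (auto simp: soft_threshold_def max_def min_def abs_if split: if_splits)

text \<open>The points of \<open>M\<close> where the soft threshold of \<open>k\<close> does not vanish stay away from the segment
  \<open>[x, y]\<close>, and the distance between two such points with different projections exceeds that of
  the projections by the sum of their heights, which absorbs the perturbation.\<close>

lemma projection_perturbation:
  assumes T: "R_tree T" and M: "M \<subseteq> T" "closed M" and xy: "x \<in> M" "y \<in> M"
    and free: "\<And>w. w \<in> M \<Longrightarrow> dist x w + dist w y = dist x y \<Longrightarrow> w = x \<or> w = y"
    and L: "0 < L" and k: "\<And>v w. v \<in> M \<Longrightarrow> w \<in> M \<Longrightarrow> \<bar>k v - k w\<bar> \<le> L * dist v w"
    and kx: "k x = 0" and ky: "k y = 0" and \<epsilon>: "0 < \<epsilon>"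
  obtains c where "0 < c" "\<And>v w. v \<in> M \<Longrightarrow> w \<in> M \<Longrightarrow>
      \<bar>(gromov_product y x v + c * soft_threshold \<epsilon> (k v))
        - (gromov_product y x w + c * soft_threshold \<epsilon> (k w))\<bar> \<le> dist v w"
proof -
  have xyT: "x \<in> T" "y \<in> T" using xy M by auto
  have "0 < \<epsilon> / L" using \<epsilon> L by simp
  then obtain \<rho> where \<rho>: "0 < \<rho>"
    "\<And>w. w \<in> M \<Longrightarrow> \<epsilon> / L \<le> dist w x \<Longrightarrow> \<epsilon> / L \<le> dist w y \<Longrightarrow> \<rho> \<le> gromov_product w x y"
    using segment_interior_separated[OF T M xyT free] by blast
  \<comment> \<open>The factor is chosen to turn the bound
    \<open>L * (dist x y / \<rho> + 2)\<close> times the height, obtained below for the soft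
    threshold, into the height itself.\<close>
  define c where "c = 1 / (L * (dist x y / \<rho> + 2))"
  have q: "0 \<le> dist x y / \<rho>" using \<rho> by simp
  then have pos: "0 < L * (dist x y / \<rho> + 2)" using L by simp
  have c: "0 < c" "c * L \<le> 1"
    using pos q L by (auto simp: c_def)
  have h0: "0 \<le> gromov_product w x y" for w by (rule gromov_product_nonneg)
  let ?S = "\<lambda>w. soft_threshold \<epsilon> (k w)"
  have small: "c * \<bar>?S w\<bar> \<le> gromov_product w x y" if w: "w \<in> M" for w
  proof (cases "?S w = 0")
    case True
    then show ?thesis using h0 by simp
  next
    case False
    \<comment> \<open>As \<open>k\<close> vanishes at \<open>x\<close> and \<open>y\<close>, a value
      above \<open>\<epsilon>\<close> forces distance at least \<open>\<epsilon> / L\<close> from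
      both.\<close>
    then have "\<epsilon> < \<bar>k w\<bar>" using soft_threshold_props(3)[OF \<epsilon>, of "k w"] by linarith
    then have "\<epsilon> / L \<le> dist w x" "\<epsilon> / L \<le> dist w y"
      using k[OF w xy(1)] k[OF w xy(2)] kx ky L by (auto simp: field_simps)
    then have h: "\<rho> \<le> gromov_product w x y" using \<rho>(2) w by blast
    have "\<bar>?S w\<bar> \<le> L * dist w x"
      using soft_threshold_props(4)[OF \<epsilon>, of "k w"] k[OF w xy(1)] kx by simp
    also have "\<dots> \<le> L * (dist x y + 2 * gromov_product w x y)"
      using L by (intro mult_left_mono) (auto simp: gromov_product_def field_simps)
    also have "\<dots> \<le> L * ((dist x y / \<rho> + 2) * gromov_product w x y)"
    proof (intro mult_left_mono)
      have "dist x y / \<rho> * \<rho> \<le> dist x y / \<rho> * gromov_product w x y"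
        using h q by (rule mult_left_mono)
      then show "dist x y + 2 * gromov_product w x y
          \<le> (dist x y / \<rho> + 2) * gromov_product w x y"
        using \<rho>(1) by (simp add: distrib_right)
    qed (use L in simp)
    finally have "c * \<bar>?S w\<bar> \<le> c * (L * ((dist x y / \<rho> + 2) * gromov_product w x y))"
      using c(1) by (intro mult_left_mono) auto
    also have "\<dots> = (c * (L * (dist x y / \<rho> + 2))) * gromov_product w x y"
      by (simp add: mult.assoc)
    also have "c * (L * (dist x y / \<rho> + 2)) = 1"
      unfolding c_def using pos by (metis less_irrefl nonzero_eq_divide_eq)
    finally show ?thesis by simp
  qed
  show thesis
  proof (rule that[OF c(1)])
    fix v w assume vw: "v \<in> M" "w \<in> M"
    have "c * \<bar>?S v - ?S w\<bar> = \<bar>c * ?S v - c * ?S w\<bar>"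
      using c(1) by (simp add: right_diff_distrib[symmetric] abs_mult)
    then have split: "\<bar>(gromov_product y x v + c * ?S v) - (gromov_product y x w + c * ?S w)\<bar>
        \<le> \<bar>gromov_product y x v - gromov_product y x w\<bar> + c * \<bar>?S v - ?S w\<bar>"
      by linarith
    show "\<bar>(gromov_product y x v + c * ?S v) - (gromov_product y x w + c * ?S w)\<bar> \<le> dist v w"
    proof (cases "gromov_product y x v = gromov_product y x w")
      \<comment> \<open>With equal projections only the perturbation varies, and
        \<open>c * L\<close> is at most 1.\<close>
      case True
      have "\<bar>?S v - ?S w\<bar> \<le> L * dist v w"
        using soft_threshold_props(1)[OF \<epsilon>, of "k v" "k w"] k[OF vw] by simp
      then have "c * \<bar>?S v - ?S w\<bar> \<le> (c * L) * dist v w" using c(1) by simp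
      also have "\<dots> \<le> 1 * dist v w" using c(2) by (rule mult_right_mono) simp
      finally show ?thesis using split True by simp
    next
      case False
      have "c * \<bar>?S v - ?S w\<bar> \<le> c * (\<bar>?S v\<bar> + \<bar>?S w\<bar>)"
        using c(1) by (intro mult_left_mono) auto
      also have "\<dots> \<le> gromov_product v x y + gromov_product w x y"
        using small[OF vw(1)] small[OF vw(2)] by (simp add: distrib_left)
      finally have "c * \<bar>?S v - ?S w\<bar> \<le> gromov_product v y x + gromov_product w y x"
        by (simp add: gromov_product_commute)
      then show ?thesis
        using split dist_ge_through_projections[OF T xyT(2,1) _ _ False] vw M by fastforce
    qed
  qed
qed

section \<open>Molecules as extreme points\<close>

lemma convex_combination_eq_max:
  fixes a b t :: real
  assumes "a \<le> c" "b \<le> c" "(1 - t) * a + t * b = c" "0 < t" "t < 1"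
  shows "a = c" "b = c"
proof -
  have "(1 - t) * (c - a) + t * (c - b) = 0" using assms(3) by (simp add: algebra_simps)
  moreover have "0 \<le> (1 - t) * (c - a)" "0 \<le> t * (c - b)" using assms by auto
  ultimately have "(1 - t) * (c - a) = 0" "t * (c - b) = 0" by linarith+
  then show "a = c" "b = c" using assms by auto
qed

lemma free_ball_apply_le:
  assumes "\<mu> \<in> free_ball M z" "F \<in> lip_ball M z" "z \<in> M"
  shows "\<mu> F \<le> 1"
proof -
  have F: "F \<in> Lip0 M z" "lip_norm M F \<le> 1" using assms by (auto simp: lip_ball_def)
  have "\<bar>\<mu> F\<bar> \<le> dual_norm M z \<mu> * lip_norm M F"
    using assms F by (intro dual_norm_bound) (auto simp: free_ball_def free_space_def)
  also have "\<dots> \<le> 1 * 1"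
    using assms F lip_norm_bound(2)[OF F(1)] by (intro mult_mono) (auto simp: free_ball_def)
  finally show ?thesis by simp
qed

text \<open>It suffices that \<open>\<mu>\<close> vanishes on each \<open>g\<close> with equal
  values at \<open>x\<close> and \<open>y\<close>. Such a \<open>g\<close> is approximated
  uniformly, with bounded Lipschitz norm, by functions \<open>h\<close> for which
  \<open>f + c *\<^sub>R h\<close> still norms the pair; comparing with \<open>f\<close> gives
  \<open>\<mu> h = 0\<close>.\<close>

lemma norming_functional_eq_molecule:
  assumes T: "R_tree T" and M: "M \<subseteq> T" "closed M" and xy: "x \<in> M" "y \<in> M" "x \<noteq> y"
    and z: "z \<in> M"
    and free: "\<And>w. w \<in> M \<Longrightarrow> dist x w + dist w y = dist x y \<Longrightarrow> w = x \<or> w = y"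
    and \<mu>: "\<mu> \<in> free_space M z"
    and one: "\<And>F. F \<in> lip_ball M z \<Longrightarrow> F x - F y = dist x y \<Longrightarrow> \<mu> F = 1"
  shows "\<mu> = molecule M z x y"
proof
  have \<mu>d: "\<mu> \<in> lip_dual M z" using \<mu> by (simp add: free_space_def)
  have add: "\<mu> (f + g) = \<mu> f + \<mu> g" and scale: "\<mu> (c *\<^sub>R f) = c * \<mu> f"
    if "f \<in> Lip0 M z" "g \<in> Lip0 M z" for f g c
    using \<mu>d that unfolding lip_dual_def by blast+
  define f where "f = rebase M z (gromov_product y x)"
  have f: "f \<in> Lip0 M z" "lip_norm M f \<le> 1"
    unfolding f_def using gromov_product_lipschitz[of y x]
    by (auto intro!: rebase_in_Lip0[where L = 1])
  have fxy: "f x - f y = dist x y"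
    using xy by (simp add: f_def rebase_def gromov_product_def dist_commute)
  then have \<mu>f: "\<mu> f = 1" using one f by (simp add: lip_ball_def)
  have zero: "\<mu> g = 0" if g: "g \<in> Lip0 M z" and gxy: "g x = g y" for g
  proof -
    define L where "L = lip_norm M g + 1"
    have L: "0 < L" using lip_norm_bound(2)[OF g z z] by (simp add: L_def)
    have gL: "\<bar>g v - g w\<bar> \<le> L * dist v w" if "v \<in> M" "w \<in> M" for v w
      using lip_norm_bound(1)[OF g that] zero_le_dist[of v w]
      unfolding L_def distrib_right by linarith
    \<comment> \<open>The shift makes both ends zeros of \<open>k\<close>, so that the soft
      threshold acts near them.\<close>
    define k where "k = (\<lambda>w. g w - g x)"
    show ?thesis
    proof (rule free_space_eq_0[OF \<mu> z g, where L = "2 * L"])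
      fix \<epsilon> :: real assume "0 < \<epsilon>"
      then have \<epsilon>: "0 < \<epsilon> / 2" by simp
      let ?S = "\<lambda>w. soft_threshold (\<epsilon> / 2) (k w)"
      have kL: "\<bar>k v - k w\<bar> \<le> L * dist v w" if "v \<in> M" "w \<in> M" for v w
        using gL[OF that] by (simp add: k_def)
      have k0: "k x = 0" "k y = 0" using gxy by (auto simp: k_def)
      obtain c where c: "0 < c" "\<And>v w. v \<in> M \<Longrightarrow> w \<in> M \<Longrightarrow>
          \<bar>(gromov_product y x v + c * ?S v) - (gromov_product y x w + c * ?S w)\<bar> \<le> dist v w"
        using projection_perturbation[OF T M xy(1,2) free L kL k0 \<epsilon>] by blast
      define h where "h = rebase M z ?S"
      have SL: "\<bar>?S v - ?S w\<bar> \<le> L * dist v w" if "v \<in> M" "w \<in> M" for v w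
        using soft_threshold_props(1)[OF \<epsilon>, of "k v" "k w"] kL[OF that] by simp
      have h: "h \<in> Lip0 M z" "lip_norm M h \<le> L"
        unfolding h_def using SL L by (auto intro!: rebase_in_Lip0[where L = L])
      have "rebase M z (\<lambda>w. gromov_product y x w + c * ?S w) \<in> lip_ball M z"
        unfolding lip_ball_def using c(2) by (auto intro!: rebase_in_Lip0[where L = 1])
      moreover have eq: "rebase M z (\<lambda>w. gromov_product y x w + c * ?S w) = f + c *\<^sub>R h"
        by (auto simp: fun_eq_iff f_def h_def rebase_def right_diff_distrib)
      moreover have "h x = h y" using xy k0 by (simp add: h_def rebase_def)
      ultimately have "\<mu> (f + c *\<^sub>R h) = 1" using one[of "f + c *\<^sub>R h"] fxy by simp
      then have "\<mu> h = 0"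
        using add[OF f(1) subspace_scale[OF subspace_Lip0 h(1)]] scale[OF h(1) h(1)] \<mu>f c(1) by simp
      moreover have "lip_norm M (g - h) \<le> 2 * L"
      proof (rule lip_norm_le)
        fix v w assume vw: "v \<in> M" "w \<in> M"
        have "h v - h w = ?S v - ?S w" using vw by (simp add: h_def rebase_def)
        then show "(g - h) v - (g - h) w \<le> 2 * L * dist v w"
          using gL[OF vw] SL[OF vw] by simp
      qed (use L in simp)
      moreover have "\<bar>g w - h w\<bar> \<le> \<epsilon>" if w: "w \<in> M" for w
      proof -
        have "g z = 0" using g by (simp add: Lip0_def)
        then have "g w - h w = (k w - ?S w) - (k z - ?S z)"
          using w by (simp add: h_def rebase_def k_def)
        then show ?thesis
          using soft_threshold_props(2)[OF \<epsilon>, of "k w"] soft_threshold_props(2)[OF \<epsilon>, of "k z"]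
          by linarith
      qed
      ultimately show "\<exists>h\<in>Lip0 M z. lip_norm M (g - h) \<le> 2 * L
          \<and> (\<forall>w\<in>M. \<bar>g w - h w\<bar> \<le> \<epsilon>) \<and> \<mu> h = 0" using h by blast
    qed
  qed
  fix g
  show "\<mu> g = molecule M z x y g"
  proof (cases "g \<in> Lip0 M z")
    case True
    \<comment> \<open>Subtracting \<open>s *\<^sub>R f\<close> equalises the values at
      \<open>x\<close> and \<open>y\<close>.\<close>
    define s where "s = (g x - g y) / dist x y"
    have sf: "s *\<^sub>R f \<in> Lip0 M z" by (rule subspace_scale[OF subspace_Lip0 f(1)])
    have gs: "g - s *\<^sub>R f \<in> Lip0 M z" by (rule subspace_diff[OF subspace_Lip0 True sf])
    have "s * (f x - f y) = g x - g y" unfolding fxy s_def using xy by simp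
    then have "(g - s *\<^sub>R f) x = (g - s *\<^sub>R f) y" by (simp add: right_diff_distrib)
    then have "\<mu> (g - s *\<^sub>R f) = 0" by (rule zero[OF gs])
    moreover have "\<mu> ((g - s *\<^sub>R f) + s *\<^sub>R f) = \<mu> (g - s *\<^sub>R f) + s * \<mu> f"
      using add[OF gs sf] scale[OF f(1) f(1)] by simp
    ultimately show ?thesis using \<mu>f True by (simp add: molecule_apply s_def)
  next
    case False
    then show ?thesis using \<mu>d by (simp add: lip_dual_def molecule_def delta_def)
  qed
qed

text \<open>Both ends of a segment through the molecule attain the maximal value 1 at every function
  of the ball that norms the pair, and this determines them.\<close>

lemma molecule_extreme_point:
  assumes T: "R_tree T" and M: "M \<subseteq> T" "closed M" and xy: "x \<in> M" "y \<in> M" "x \<noteq> y"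
    and z: "z \<in> M"
    and free: "\<And>w. w \<in> M \<Longrightarrow> dist x w + dist w y = dist x y \<Longrightarrow> w = x \<or> w = y"
  shows "molecule M z x y extreme_point_of free_ball M z"
  unfolding extreme_point_of_def
proof (intro conjI ballI notI)
  show "molecule M z x y \<in> free_ball M z" by (rule molecule_in_free_ball[OF z xy(1,2)])
  fix \<mu> \<nu> assume \<mu>: "\<mu> \<in> free_ball M z" and \<nu>: "\<nu> \<in> free_ball M z"
    and "molecule M z x y \<in> open_segment \<mu> \<nu>"
  then obtain t where t: "\<mu> \<noteq> \<nu>" "0 < t" "t < 1"
    "molecule M z x y = (1 - t) *\<^sub>R \<mu> + t *\<^sub>R \<nu>" by (auto simp: in_segment)
  have "\<mu> F = 1" "\<nu> F = 1" if F: "F \<in> lip_ball M z" "F x - F y = dist x y" for F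
  proof -
    have "molecule M z x y F = 1" using F xy by (simp add: lip_ball_def molecule_apply)
    then have "(1 - t) * \<mu> F + t * \<nu> F = 1" unfolding t(4) by simp
    then show "\<mu> F = 1" "\<nu> F = 1"
      using convex_combination_eq_max[OF free_ball_apply_le[OF \<mu> F(1) z]
          free_ball_apply_le[OF \<nu> F(1) z]] t by auto
  qed
  then have "\<mu> = molecule M z x y" "\<nu> = molecule M z x y"
    using norming_functional_eq_molecule[OF T M xy z free] \<mu> \<nu> by (auto simp: free_ball_def)
  then show False using t(1) by simp
qed

text \<open>Replacing the increment from \<open>w\<close> to \<open>x\<close> by those from
  \<open>y\<close> gives coefficients whose contributions add up to \<open>2 * e / (a + e)\<close>;
  the order \<open>c \<le> e\<close> makes the first coefficient nonnegative.\<close>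

lemma molecule_dist_less_2:
  assumes M: "x \<in> M" "y \<in> M" "w \<in> M" "z \<in> M" and b: "b \<notin> M"
    and g: "gromov_product b x y = 0" "gromov_product b x w = 0" "gromov_product b y w = 0"
    and le: "dist y b \<le> dist w b"
  shows "dual_norm M z (molecule M z x y - molecule M z x w) < 2"
proof -
  define a c e where "a = dist x b" and "c = dist y b" and "e = dist w b"
  have pos: "0 < a" "0 < c" "c \<le> e" using M b le by (auto simp: a_def c_def e_def)
  have d: "dist x y = a + c" "dist x w = a + e" "dist w y = c + e"
    using g by (auto simp: gromov_product_def a_def c_def e_def dist_commute)
  have "dual_norm M z (molecule M z x y - molecule M z x w) \<le> 2 * e / (a + e)"
  proof (rule dual_norm_le)
    fix f assume "f \<in> lip_ball M z"
    then have f: "f \<in> Lip0 M z" "lip_norm M f \<le> 1" by (auto simp: lip_ball_def)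
    have lip: "\<bar>f u - f v\<bar> \<le> dist u v" if "u \<in> M" "v \<in> M" for u v
      using lip_norm_bound(1)[OF f(1) that] mult_right_mono[OF f(2) zero_le_dist[of u v]] by simp
    have "molecule M z x y f - molecule M z x w f
        = (f x - f y) * (1 / (a + c) - 1 / (a + e)) + (f w - f y) / (a + e)"
      using f(1) by (simp add: molecule_apply d right_diff_distrib diff_divide_distrib)
    also have "\<bar>\<dots>\<bar> \<le> (a + c) * (1 / (a + c) - 1 / (a + e)) + (c + e) / (a + e)"
    proof -
      have "0 \<le> 1 / (a + c) - 1 / (a + e)" using pos by (simp add: frac_le)
      then have "\<bar>(f x - f y) * (1 / (a + c) - 1 / (a + e))\<bar>
          \<le> (a + c) * (1 / (a + c) - 1 / (a + e))"
        using lip[OF M(1,2)] d by (simp add: abs_mult mult_right_mono)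
      moreover have "\<bar>(f w - f y) / (a + e)\<bar> \<le> (c + e) / (a + e)"
        using lip[OF M(3,2)] d pos by (simp add: divide_right_mono)
      ultimately show ?thesis by linarith
    qed
    also have "(a + c) * (1 / (a + c) - 1 / (a + e)) = (e - c) / (a + e)"
      using pos by (simp add: right_diff_distrib diff_divide_eq_iff)
    also have "\<dots> + (c + e) / (a + e) = 2 * e / (a + e)" by (simp add: add_divide_distrib[symmetric])
    finally show "\<bar>(molecule M z x y - molecule M z x w) f\<bar> \<le> 2 * e / (a + e)" by simp
  qed
  also have "\<dots> < 2" using pos by (simp add: field_simps)
  finally show ?thesis .
qed

text \<open>The distance to \<open>w\<close> separates them: the molecule of \<open>x, w\<close>
  takes the value 1, that of \<open>x, y\<close> only if \<open>y\<close> lies between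
  \<open>x\<close> and \<open>w\<close>.\<close>

lemma molecule_neq:
  assumes M: "x \<in> M" "y \<in> M" "w \<in> M" "z \<in> M" "x \<noteq> y" "x \<noteq> w"
    and strict: "dist x w < dist x y + dist y w"
  shows "molecule M z x y \<noteq> molecule M z x w"
proof
  assume eq: "molecule M z x y = molecule M z x w"
  have L: "rebase M z (\<lambda>v. dist v w) \<in> Lip0 M z"
    using abs_dist_diff_le[of _ w] by (intro rebase_in_Lip0[where L = 1]) (auto simp: dist_commute)
  have "molecule M z x y (rebase M z (\<lambda>v. dist v w)) = (dist x w - dist y w) / dist x y"
    "molecule M z x w (rebase M z (\<lambda>v. dist v w)) = 1"
    using L M by (simp_all add: molecule_apply rebase_def)
  then have "(dist x w - dist y w) / dist x y = 1" using eq by metis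
  then have "dist x w - dist y w = dist x y" using M(5) by simp
  then show False using strict by simp
qed

section \<open>Extreme Lipschitz functions\<close>

text \<open>In terms of the projection \<open>u\<close> and the height \<open>h\<close> over the segment \<open>[x, a]\<close> this function
  is \<open>\<bar>u - t\<bar> - h\<close>: it increases from the point at position \<open>t\<close> towards both ends and decreases
  along everything that branches off.\<close>

definition valley :: "'a::metric_space \<Rightarrow> 'a \<Rightarrow> real \<Rightarrow> 'a \<Rightarrow> real" where
  "valley x a t w = max (t - dist w x) (dist x a - t - dist w a)"

lemma valley_eq: "valley x a t w = \<bar>gromov_product x a w - t\<bar> - gromov_product w x a"
  by (simp add: valley_def gromov_product_def max_def abs_if dist_commute field_simps)

lemma valley_lipschitz: "\<bar>valley x a t v - valley x a t w\<bar> \<le> dist v w"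
  using abs_dist_diff_le[of v x w] abs_dist_diff_le[of v a w]
    dist_triangle[of v x w] dist_triangle[of v a w] dist_triangle[of w x v] dist_triangle[of w a v]
  by (auto simp: valley_def max_def dist_commute abs_if)

lemma rebase_valley_in_lip_ball: "rebase M z (valley x a t) \<in> lip_ball M z"
  unfolding lip_ball_def using valley_lipschitz[of x a t]
  by (auto intro!: rebase_in_Lip0[where L = 1])

text \<open>If the function is a convex combination of \<open>g\<close> and \<open>h\<close>, then
  \<open>h\<close> differs from it by nearly the same amount at two points between which it has
  nearly maximal slope. Every point of \<open>M\<close> forms a tight pair with \<open>x\<close> or
  with \<open>a\<close>, and points with position near \<open>t\<close> link \<open>x\<close> to
  \<open>a\<close>.\<close>

lemma valley_extreme_point:
  assumes xa: "x \<in> M" "a \<in> M" and z: "z \<in> M" and t: "0 \<le> t" "t \<le> dist x a"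
    and lim: "\<And>\<epsilon>. 0 < \<epsilon> \<Longrightarrow> \<exists>w\<in>M. \<bar>gromov_product x a w - t\<bar> < \<epsilon>"
  shows "rebase M z (valley x a t) extreme_point_of lip_ball M z"
  unfolding extreme_point_of_def
proof (intro conjI ballI notI)
  let ?f = "valley x a t"
  show "rebase M z ?f \<in> lip_ball M z" by (rule rebase_valley_in_lip_ball)
  fix g h assume g: "g \<in> lip_ball M z" and h: "h \<in> lip_ball M z"
    and "rebase M z ?f \<in> open_segment g h"
  then obtain l where l: "g \<noteq> h" "0 < l" "l < 1"
    "rebase M z ?f = (1 - l) *\<^sub>R g + l *\<^sub>R h" by (auto simp: in_segment)
  have lip: "F v - F w \<le> dist v w" if "F \<in> lip_ball M z" "v \<in> M" "w \<in> M" for F v w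
    using that lip_norm_bound(1)[of F M z v w]
      mult_right_mono[of "lip_norm M F" 1 "dist v w"] by (auto simp: lip_ball_def)
  have f: "?f v - ?f w = (1 - l) * (g v - g w) + l * (h v - h w)" if "v \<in> M" "w \<in> M" for v w
    using fun_cong[OF l(4), of v] fun_cong[OF l(4), of w] that
    by (simp add: rebase_def algebra_simps)
  have slack: "l * \<bar>(h v - h w) - dist v w\<bar> \<le> dist v w - (?f v - ?f w)"
    if vw: "v \<in> M" "w \<in> M" for v w
  proof -
    have "(1 - l) * (g v - g w) \<le> (1 - l) * dist v w"
      using lip[OF g vw] l by (intro mult_left_mono) auto
    then show ?thesis using f[OF vw] lip[OF h vw] by (simp add: algebra_simps)
  qed
  have fx: "?f x = t" and fa: "?f a = dist x a - t"
    using t by (auto simp: valley_def max_def dist_commute)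
  define \<Delta> where "\<Delta> = (\<lambda>w. h w - ?f w)"
  have tight: "l * \<bar>\<Delta> v - \<Delta> w\<bar> \<le> (1 + l) * (dist v w - (?f v - ?f w))"
    if vw: "v \<in> M" "w \<in> M" for v w
  proof -
    have "0 \<le> dist v w - (?f v - ?f w)" using valley_lipschitz[of x a t v w] by linarith
    then have "\<bar>\<Delta> v - \<Delta> w\<bar> \<le> \<bar>(h v - h w) - dist v w\<bar> + (dist v w - (?f v - ?f w))"
      unfolding \<Delta>_def by linarith
    then have "l * \<bar>\<Delta> v - \<Delta> w\<bar> \<le> l * \<bar>(h v - h w) - dist v w\<bar> + l * (dist v w - (?f v - ?f w))"
      using l(2) by (simp add: distrib_left[symmetric])
    then show ?thesis using slack[OF vw] by (simp add: algebra_simps)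
  qed
  have sx: "dist x w - (?f x - ?f w) \<le> 2 * \<bar>gromov_product x a w - t\<bar>"
    and sa: "dist a w - (?f a - ?f w) \<le> 2 * \<bar>gromov_product x a w - t\<bar>" for w
    unfolding valley_eq[of x a t w] fx fa
    by (auto simp: gromov_product_def dist_commute abs_if field_simps)
  have "l * \<bar>\<Delta> x - \<Delta> a\<bar> \<le> 0"
  proof (rule field_le_epsilon)
    fix \<epsilon> :: real assume "0 < \<epsilon>"
    then obtain w where w: "w \<in> M" "\<bar>gromov_product x a w - t\<bar> < \<epsilon> / 8"
      using lim[of "\<epsilon> / 8"] by auto
    \<comment> \<open>The factor \<open>1 + l\<close> is below 2 and the defect at most
      \<open>2 * (\<epsilon> / 8)\<close>, so each of the two links costs at most half of
      \<open>\<epsilon>\<close>.\<close>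
    have "l * \<bar>\<Delta> x - \<Delta> w\<bar> \<le> 2 * (2 * (\<epsilon> / 8))" "l * \<bar>\<Delta> a - \<Delta> w\<bar> \<le> 2 * (2 * (\<epsilon> / 8))"
    proof -
      have "(1 + l) * (dist v w - (?f v - ?f w)) \<le> 2 * (2 * (\<epsilon> / 8))"
        if "v \<in> {x, a}" for v
        using sx[of w] sa[of w] w l valley_lipschitz[of x a t v w] that
        by (intro mult_mono) auto
      then show "l * \<bar>\<Delta> x - \<Delta> w\<bar> \<le> 2 * (2 * (\<epsilon> / 8))" "l * \<bar>\<Delta> a - \<Delta> w\<bar> \<le> 2 * (2 * (\<epsilon> / 8))"
        using tight[OF xa(1) w(1)] tight[OF xa(2) w(1)] by force+
    qed
    moreover have "l * \<bar>\<Delta> x - \<Delta> a\<bar> \<le> l * (\<bar>\<Delta> x - \<Delta> w\<bar> + \<bar>\<Delta> a - \<Delta> w\<bar>)"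
      using l(2) by (intro mult_left_mono) auto
    ultimately show "l * \<bar>\<Delta> x - \<Delta> a\<bar> \<le> 0 + \<epsilon>" by (simp add: distrib_left)
  qed
  then have xa_eq: "\<Delta> x = \<Delta> a" using l(2) by (simp add: mult_le_0_iff)
  have const: "\<Delta> w = \<Delta> x" if w: "w \<in> M" for w
  proof -
    \<comment> \<open>One of the two functions whose maximum is the valley attains it at
      \<open>w\<close>.\<close>
    have "dist x w - (?f x - ?f w) = 0 \<or> dist a w - (?f a - ?f w) = 0"
      unfolding fx fa by (auto simp: valley_def max_def dist_commute)
    then have "\<Delta> x = \<Delta> w \<or> \<Delta> a = \<Delta> w"
      using tight[OF xa(1) w] tight[OF xa(2) w] l(2) by (auto simp: mult_le_0_iff)
    then show ?thesis using xa_eq by auto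
  qed
  have "h = rebase M z ?f"
  proof
    fix w
    show "h w = rebase M z ?f w"
      using h const[of w] const[OF z] by (auto simp: rebase_def \<Delta>_def lip_ball_def Lip0_def)
  qed
  then have eq: "h = (1 - l) *\<^sub>R g + l *\<^sub>R h" using l(4) by simp
  have "g = h"
  proof
    fix w
    have "(1 - l) * (g w - h w) = 0" using fun_cong[OF eq, of w] by (simp add: algebra_simps)
    then show "g w = h w" using l by simp
  qed
  then show False using l(1) by simp
qed

text \<open>The heights cancel, leaving a function of the position that has slope 2 between the
  positions of \<open>b\<close> and \<open>t\<close> and is constant elsewhere. A pair whose
  positions overlap this interval in length \<open>p\<close> is at distance at least
  \<open>p + r / 2\<close>.\<close>

lemma valley_dist_le:
  assumes T: "R_tree T" and M: "M \<subseteq> T" and xa: "x \<in> M" "a \<in> M" and b: "b \<in> T"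
    and seg: "dist x b + dist b a = dist x a" and r: "0 < r" "\<And>w. w \<in> M \<Longrightarrow> r \<le> dist w b"
    and st: "dist x b < t"
    and high: "\<And>w. w \<in> M \<Longrightarrow> dist x b < gromov_product x a w \<Longrightarrow> gromov_product x a w < t \<Longrightarrow>
        r / 2 \<le> gromov_product w x a"
  shows "lip_norm M (rebase M z (valley x a (dist x b)) - rebase M z (valley x a t)) < 2"
proof -
  define s where "s = dist x b"
  \<comment> \<open>This is \<open>2 * p / (p + r / 2)\<close>, increasing in \<open>p\<close>, at
    the largest overlap \<open>p = t - s\<close>.\<close>
  define \<kappa> where "\<kappa> = 2 * (t - s) / (t - s + r / 2)"
  let ?u = "gromov_product x a" and ?h = "\<lambda>w. gromov_product w x a"
  define \<Delta> where "\<Delta> = (\<lambda>w. \<bar>?u w - s\<bar> - \<bar>?u w - t\<bar>)"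
  have pos: "0 < t - s" "0 < t - s + r / 2" using st r by (auto simp: s_def)
  have \<kappa>: "0 \<le> \<kappa>" "\<kappa> < 2" using pos r(1) by (auto simp: \<kappa>_def field_simps)
  have xaT: "x \<in> T" "a \<in> T" using xa M by auto
  have key: "0 \<le> \<Delta> w - \<Delta> v \<and> \<Delta> w - \<Delta> v \<le> \<kappa> * dist v w"
    if vw: "v \<in> M" "w \<in> M" "?u v \<le> ?u w" for v w
  proof (cases "?u w \<le> s \<or> t \<le> ?u v \<or> ?u v = ?u w")
    case True
    then have "\<Delta> w = \<Delta> v" using vw(3) st by (auto simp: \<Delta>_def s_def abs_if)
    then show ?thesis using \<kappa> by simp
  next
    case False
    then have u: "s < ?u w" "?u v < t" "?u v < ?u w" using vw(3) by auto
    define p where "p = min (?u w) t - max (?u v) s"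
    have p: "0 \<le> p" "p \<le> t - s" "\<Delta> w - \<Delta> v = 2 * p"
      using u pos by (auto simp: p_def \<Delta>_def min_def max_def abs_if)
    \<comment> \<open>The extra \<open>r / 2\<close> comes from the height of \<open>v\<close> if
      \<open>v\<close> projects beyond \<open>b\<close>; otherwise from its distance to
      \<open>b\<close>, which is its height plus the stretch before \<open>b\<close>.\<close>
    have "?u w - ?u v + ?h v + ?h w \<le> dist v w"
      using dist_ge_through_projections[OF T xaT, of v w] vw M u by auto
    moreover have "r \<le> \<bar>?u v - s\<bar> + ?h v"
      using dist_point_of_segment_le[OF T xaT b, of v] r(2)[OF vw(1)] seg vw M
      by (auto simp: s_def)
    moreover have "s < ?u v \<Longrightarrow> r / 2 \<le> ?h v" using high[OF vw(1)] u by (simp add: s_def)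
    moreover have "0 \<le> ?h w" by (rule gromov_product_nonneg)
    ultimately have d: "p + r / 2 \<le> dist v w"
      using u r(1) by (auto simp: p_def min_def max_def abs_if split: if_splits)
    have "p * (r / 2) \<le> (t - s) * (r / 2)" using p(2) r(1) by (intro mult_right_mono) auto
    then have "2 * p \<le> \<kappa> * (p + r / 2)" unfolding \<kappa>_def using pos by (simp add: field_simps)
    also have "\<dots> \<le> \<kappa> * dist v w" using d \<kappa>(1) by (rule mult_left_mono)
    finally show ?thesis using p by simp
  qed
  have "lip_norm M (rebase M z (valley x a s) - rebase M z (valley x a t)) \<le> \<kappa>"
  proof (rule lip_norm_le[OF \<kappa>(1)])
    fix v w assume vw: "v \<in> M" "w \<in> M"
    have "\<Delta> v - \<Delta> w \<le> \<kappa> * dist v w"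
    proof (cases "?u v \<le> ?u w")
      case True
      then have "0 \<le> \<Delta> w - \<Delta> v" "0 \<le> \<kappa> * dist v w" using key[OF vw] \<kappa> by auto
      then show ?thesis by linarith
    next
      case False
      then show ?thesis using key[OF vw(2,1)] by (simp add: dist_commute)
    qed
    then show "(rebase M z (valley x a s) - rebase M z (valley x a t)) v
        - (rebase M z (valley x a s) - rebase M z (valley x a t)) w \<le> \<kappa> * dist v w"
      using vw by (simp add: rebase_def \<Delta>_def valley_eq)
  qed
  then show ?thesis using \<kappa> by (simp add: s_def)
qed

text \<open>Position \<open>t\<close> is the next branching position after \<open>b\<close> if there is a next one, and otherwise
  a branching position so close to \<open>b\<close> that the segment in between stays away from \<open>M\<close>.\<close>

lemma next_branching_position:
  assumes T: "R_tree T" and M: "M \<subseteq> T" and xa: "x \<in> M" "a \<in> M" and b: "b \<in> T" "b \<noteq> a"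
    and seg: "dist x b + dist b a = dist x a" and r: "0 < r" "\<And>w. w \<in> M \<Longrightarrow> r \<le> dist w b"
  obtains t where "dist x b < t" "t \<le> dist x a"
    "\<And>\<epsilon>. 0 < \<epsilon> \<Longrightarrow> \<exists>w\<in>M. \<bar>gromov_product x a w - t\<bar> < \<epsilon>"
    "\<And>w. w \<in> M \<Longrightarrow> dist x b < gromov_product x a w \<Longrightarrow> gromov_product x a w < t \<Longrightarrow>
        r / 2 \<le> gromov_product w x a"
proof -
  let ?u = "gromov_product x a" and ?s = "dist x b"
  have xaT: "x \<in> T" "a \<in> T" using xa M by auto
  have u_le: "?u w \<le> dist x a" for w
    using dist_triangle[of x w a] by (simp add: gromov_product_def dist_commute)
  define U where "U = {?u w | w. w \<in> M \<and> ?s < ?u w}"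
  have "?u a = dist x a" by (simp add: gromov_product_def)
  moreover have "?s < dist x a" using seg zero_less_dist_iff[of b a] b(2) by linarith
  ultimately have aU: "dist x a \<in> U" unfolding U_def using xa by force
  have bdd: "bdd_below U" unfolding U_def by (rule bdd_belowI[of _ ?s]) auto
  have ge: "?s \<le> Inf U" using aU by (intro cInf_greatest) (auto simp: U_def)
  show thesis
  proof (cases "?s < Inf U")
    case True
    show thesis
    proof (rule that[OF True])
      show "Inf U \<le> dist x a" by (rule cInf_lower[OF aU bdd])
    next
      fix \<epsilon> :: real assume "0 < \<epsilon>"
      then obtain v where v: "v \<in> U" "v < Inf U + \<epsilon>"
        using cInf_lessD[of U "Inf U + \<epsilon>"] aU by auto
      then have "\<bar>v - Inf U\<bar> < \<epsilon>" using cInf_lower[OF v(1) bdd] by simp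
      then show "\<exists>w\<in>M. \<bar>?u w - Inf U\<bar> < \<epsilon>" using v(1) by (auto simp: U_def)
    next
      \<comment> \<open>This case is void: no position of \<open>M\<close> lies strictly between
        that of \<open>b\<close> and the infimum.\<close>
      fix w assume "w \<in> M" "?s < ?u w" "?u w < Inf U"
      then have "Inf U \<le> ?u w" using bdd by (intro cInf_lower) (auto simp: U_def)
      then show "r / 2 \<le> gromov_product w x a" using \<open>?u w < Inf U\<close> by simp
    qed
  next
    case False
    then have "Inf U < ?s + r / 2" using r by simp
    then obtain v where "v \<in> U" "v < ?s + r / 2" using cInf_lessD[of U "?s + r / 2"] aU by auto
    then obtain w0 where w0: "w0 \<in> M" "?s < ?u w0" "?u w0 < ?s + r / 2" unfolding U_def by blast
    show thesis
    proof (rule that[OF w0(2) u_le])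
      show "\<exists>w\<in>M. \<bar>?u w - ?u w0\<bar> < \<epsilon>" if "0 < \<epsilon>" for \<epsilon> using w0(1) that by force
    next
      fix w assume w: "w \<in> M" "?s < ?u w" "?u w < ?u w0"
      \<comment> \<open>Less than half of the distance \<open>r\<close> from \<open>b\<close> is
        covered along the segment, so the height makes up the rest.\<close>
      have "r \<le> \<bar>?u w - ?s\<bar> + gromov_product w x a"
        using dist_point_of_segment_le[OF T xaT b(1), of w] r(2)[OF w(1)] seg w M by auto
      then show "r / 2 \<le> gromov_product w x a" using w w0 by simp
    qed
  qed
qed

section \<open>Both pairs of extreme points from one tripod at \<open>b\<close>\<close>

theorem theorem4:
  fixes T M :: "'a::metric_space set" and z b :: 'a
  assumes "R_tree T" and "M \<subseteq> T" and "complete M" and "z \<in> M"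
    and "b \<in> Br T M - M"
  shows "(\<exists>\<mu> \<nu>. \<mu> extreme_point_of free_ball M z \<and> \<nu> extreme_point_of free_ball M z \<and>
            \<mu> \<noteq> \<nu> \<and> dual_norm M z (\<mu> - \<nu>) < 2) \<and>
         (\<exists>f g. f extreme_point_of lip_ball M z \<and> g extreme_point_of lip_ball M z \<and>
            f \<noteq> g \<and> lip_norm M (f - g) < 2)"
proof -
  note T = assms(1) and M = assms(2) and z = assms(4)
  have cl: "closed M" using assms(3) by (rule complete_imp_closed)
  have b: "b \<in> Br T M" "b \<notin> M" using assms(5) by auto
  have bT: "b \<in> T"
    using b tree_conv_subset[OF T M] by (auto simp: Br_def branching_point_def)
  obtain x p q where *: "x \<in> M" "p \<in> M" "q \<in> M" "gromov_product b x p = 0"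
    "gromov_product b x q = 0" "gromov_product b p q = 0"
    "\<forall>o'\<in>{x, p, q}. \<forall>v\<in>M. dist o' v + dist v b = dist o' b \<longrightarrow> v = o'"
    by (rule branching_point_tripod[OF T M cl b])
  \<comment> \<open>The ends other than \<open>x\<close> are ordered by distance to
    \<open>b\<close>, as the estimate for the two molecules requires.\<close>
  define y where "y = (if dist p b \<le> dist q b then p else q)"
  define w where "w = (if dist p b \<le> dist q b then q else p)"
  have in_M: "x \<in> M" "y \<in> M" "w \<in> M" and le: "dist y b \<le> dist w b"
    and g: "gromov_product b x y = 0" "gromov_product b x w = 0" "gromov_product b y w = 0"
    and near: "\<forall>o'\<in>{x, y, w}. \<forall>v\<in>M. dist o' v + dist v b = dist o' b \<longrightarrow> v = o'"
    using * by (auto simp: y_def w_def gromov_product_commute)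
  have nb: "x \<noteq> b" "y \<noteq> b" "w \<noteq> b" using in_M b by auto
  have d: "dist x y = dist x b + dist b y" "dist x w = dist x b + dist b w"
    "dist y w = dist y b + dist b w"
    using g by (auto simp: gromov_product_def dist_commute)
  have ne: "x \<noteq> y" "x \<noteq> w" using d nb by (auto simp: dist_commute)
  have free: "v = x \<or> v = o'"
    if "o' \<in> {y, w}" "v \<in> M" "dist x v + dist v o' = dist x o'" for v o'
  proof (rule tripod_segment_disjoint[OF T _ _ bT])
    show "x \<in> T" "o' \<in> T" "v \<in> T" using that in_M M by auto
    show "gromov_product b x o' = 0" using that(1) g by blast
    show "v = x" if "dist x v + dist v b = dist x b" using near \<open>v \<in> M\<close> that by blast
    show "v = o'" if "dist o' v + dist v b = dist o' b"
      using near \<open>v \<in> M\<close> \<open>o' \<in> {y, w}\<close> that by blast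
  qed fact
  have "molecule M z x y extreme_point_of free_ball M z"
    "molecule M z x w extreme_point_of free_ball M z"
    using free by (auto intro!: molecule_extreme_point[OF T M cl] in_M ne z)
  moreover have "molecule M z x y \<noteq> molecule M z x w"
    by (rule molecule_neq) (use in_M z ne d nb in \<open>auto simp: dist_commute\<close>)
  moreover have "dual_norm M z (molecule M z x y - molecule M z x w) < 2"
    by (rule molecule_dist_less_2[OF in_M z b(2) g le])
  moreover have "\<exists>f g. f extreme_point_of lip_ball M z \<and> g extreme_point_of lip_ball M z \<and>
      f \<noteq> g \<and> lip_norm M (f - g) < 2"
  proof -
    obtain r where "0 < r" "\<forall>p\<in>{b}. \<forall>v\<in>M. r \<le> dist p v"
      by (rule compact_closed_separated[of "{b}" M]) (use cl b(2) in auto)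
    then have r: "0 < r" "\<And>v. v \<in> M \<Longrightarrow> r \<le> dist v b" by (auto simp: dist_commute)
    obtain t where t: "dist x b < t" "t \<le> dist x y"
      "\<And>\<epsilon>. 0 < \<epsilon> \<Longrightarrow> \<exists>v\<in>M. \<bar>gromov_product x y v - t\<bar> < \<epsilon>"
      "\<And>v. v \<in> M \<Longrightarrow> dist x b < gromov_product x y v \<Longrightarrow> gromov_product x y v < t \<Longrightarrow>
          r / 2 \<le> gromov_product v x y"
      using next_branching_position[OF T M in_M(1,2) bT nb(2)[symmetric] d(1)[symmetric] r] by blast
    let ?f = "\<lambda>t. rebase M z (valley x y t)"
    \<comment> \<open>The third end projects exactly to \<open>b\<close>, which makes the position
      of \<open>b\<close> admissible although \<open>b\<close> is not in \<open>M\<close>.\<close>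
    have u: "gromov_product x y w = dist x b"
      using d by (simp add: gromov_product_def dist_commute)
    have "?f (dist x b) extreme_point_of lip_ball M z"
    proof (rule valley_extreme_point[OF in_M(1,2) z])
      show "\<exists>v\<in>M. \<bar>gromov_product x y v - dist x b\<bar> < \<epsilon>" if "0 < \<epsilon>" for \<epsilon>
        using in_M(3) u that by force
    qed (use d in auto)
    moreover have "?f t extreme_point_of lip_ball M z"
      by (rule valley_extreme_point[OF in_M(1,2) z _ t(2,3)]) (use t(1) zero_le_dist[of x b] in linarith)
    moreover have "lip_norm M (?f (dist x b) - ?f t) < 2"
      by (rule valley_dist_le[OF T M in_M(1,2) bT d(1)[symmetric] r t(1,4)])
    moreover have "?f (dist x b) \<noteq> ?f t"
    proof
      assume eq: "?f (dist x b) = ?f t"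
      \<comment> \<open>The increment between the ends recovers the position of the valley.\<close>
      have "valley x y s x - valley x y s y = 2 * s - dist x y" if "0 \<le> s" "s \<le> dist x y" for s
        using that by (auto simp: valley_def max_def dist_commute)
      from this[of "dist x b"] this[of t] have "dist x b = t"
        using fun_cong[OF eq, of x] fun_cong[OF eq, of y] in_M t(1,2) d(1) zero_le_dist[of x b]
        by (simp add: rebase_def)
      then show False using t(1) by simp
    qed
    ultimately show ?thesis by blast
  qed
  ultimately show ?thesis by blast
qed

end
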